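(* Let $V$ be the value assigned to $t^{\ast,V}(1)$ in the stuffle regularisation of multiple $t$ values. For all integers $a,b\ge 0$, $$t^{\ast,V}(\{2\}^a,1,\{2\}^b) = -\sum_{r=1}^{a+b} (-1)^r 2^{-2r}\left[\binom{2r}{2a}+\frac{2^{2r}}{2^{2r}-1}\binom{2r}{2b}\right]\zeta(\overline{2r+1})\,t(\{2\}^{a+b-r}) + \delta_{a=0}\log(2)\,t(\{2\}^b)+\delta_{b=0}\,(V-\log(2))\,t(\{2\}^a).$$
   Context: For integers $k_1,\ldots,k_d\ge1$ with $k_d\ge2$, the multiple $t$ value (MtV) is $t(k_1,\ldots,k_d)=\sum_{0<n_1<\cdots<n_d}\prod_{i=1}^d(2n_i-1)^{-k_i}$, with $t(\emptyset)=1$. Stuffle regularisation: $t^{\ast,V}$ is the unique assignment of a value to every index $(k_1,\ldots,k_d)$, $k_i\ge1$, which agrees with $t$ when $k_d\ge2$ (or the index is empty), satisfies $t^{\ast,V}(1)=V$, and satisfies the stuffle product $t^{\ast,V}(\mathbf{u})\,t^{\ast,V}(\mathbf{v})=t^{\ast,V}(\mathbf{u}\ast\mathbf{v})$ (extended linearly), where $\emptyset\ast\mathbf{u}=\mathbf{u}\ast\emptyset=\mathbf{u}$ and $(a,\mathbf{u})\ast(b,\mathbf{v})=(a,\mathbf{u}\ast(b,\mathbf{v}))+(b,(a,\mathbf{u})\ast\mathbf{v})+(a+b,\mathbf{u}\ast\mathbf{v})$. Notation: $\{k\}^n$ is $k$ repeated $n$ times; $\zeta(\overline{m})=\sum_{n\ge1}(-1)^n/n^m$;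 $\delta_\bullet$ is $1$ if the condition $\bullet$ holds and $0$ otherwise. *)

theory Defs
  imports "HOL-Analysis.Analysis"
begin

definition is_index :: "nat list \<Rightarrow> bool" where
  "is_index ks \<longleftrightarrow> (\<forall>k\<in>set ks. 1 \<le> k)"

definition admissible :: "nat list \<Rightarrow> bool" where
  "admissible ks \<longleftrightarrow> is_index ks \<and> (ks = [] \<or> 2 \<le> last ks)"

text \<open>The list \<open>ns\<close> holds the summation variables \<open>0 < n_1 < \<dots> < n_d\<close>. The terms are positive
  reals, so the unordered sum is the usual one; it is only meaningful for admissible \<open>ks\<close>.\<close>

definition mtv :: "nat list \<Rightarrow> real" where
  "mtv ks = (\<Sum>\<^sub>\<infinity>ns\<in>{ns. length ns = length ks \<and> sorted_wrt (<) ns \<and> (\<forall>n\<in>set ns. 0 < n)}.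
     \<Prod>i<length ks. 1 / (2 * real (ns ! i) - 1) ^ (ks ! i))"

text \<open>A formal sum of indices is represented by the list of its terms, with repetition.\<close>

fun stuffle :: "nat list \<Rightarrow> nat list \<Rightarrow> nat list list" where
  "stuffle [] v = [v]"
| "stuffle u [] = [u]"
| "stuffle (a # u) (b # v) =
     map ((#) a) (stuffle u (b # v)) @ map ((#) b) (stuffle (a # u) v) @
     map ((#) (a + b)) (stuffle u v)"

text \<open>The third conjunct is a convention: a regularisation is a function on indices, extended here
  by zero to lists having a zero entry, so that it is unique as a function on all lists.\<close>

definition is_stuffle_reg :: "real \<Rightarrow> (nat list \<Rightarrow> real) \<Rightarrow> bool" where
  "is_stuffle_reg V T \<longleftrightarrow>
     (\<forall>w. admissible w \<longrightarrow> T w = mtv w) \<and>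
     T [1] = V \<and>
     (\<forall>w. \<not> is_index w \<longrightarrow> T w = 0) \<and>
     (\<forall>u v. is_index u \<longrightarrow> is_index v \<longrightarrow> T u * T v = (\<Sum>w\<leftarrow>stuffle u v. T w))"

definition mtv_stuffle :: "real \<Rightarrow> nat list \<Rightarrow> real" where
  "mtv_stuffle V = (THE T. is_stuffle_reg V T)"

definition zeta_bar :: "nat \<Rightarrow> real" where
  "zeta_bar m = (\<Sum>n. (-1) ^ Suc n / real (Suc n) ^ m)"

end

theory Submission
  imports Defs "HOL-Real_Asymp.Real_Asymp"
begin

text \<open>
  Write \<open>t\<^sub>N\<close> for the sums truncated at \<open>n\<^sub>i \<le> N\<close>. They satisfy the stuffle product exactly, and every
  \<open>t\<^sub>N(w)\<close> is a polynomial \<open>P\<^sub>w\<close> in \<open>t\<^sub>N(1)\<close> up to an error that is smaller than any negative power of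
  \<open>t\<^sub>N(1) \<sim> (log N)/2\<close>; since \<open>t\<^sub>N(1)\<close> is unbounded, \<open>P\<^sub>w\<close> is unique and \<open>w \<mapsto> P\<^sub>w(V)\<close> is the regularisation.

  For \<open>w = ({2}\<^sup>a, 1, {2}\<^sup>b)\<close> the tail sums of \<open>{2}\<^sup>b\<close> over indices beyond \<open>n\<close> are Wallis-type integrals
  \<open>\<integral> cos\<^bsup>2n-1\<^esup>(x) x\<^bsup>2b\<^esup>/(2b)! dx\<close> over \<open>[0, \<pi>/2]\<close>, while the truncated sums of \<open>{2}\<^sup>a\<close> are the coefficients of
  an expansion of \<open>y\<^bsup>2a\<^esup>/(2a)!\<close> in powers of \<open>sin y\<close>. Together they give
  \<open>P\<^sub>w(X) = c X + \<integral> cot(x) (f(x) - f(0)) dx\<close> with \<open>f(x) = (\<pi>/2 - x)\<^bsup>2a\<^esup>/(2a)! \<cdot> x\<^bsup>2b\<^esup>/(2b)!\<close> and \<open>c = f(0)\<close>.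
  Expanding \<open>cot\<close> into \<open>2 \<Sum> sin(2kx)\<close> and integrating by parts turns the integral into a combination of
  zeta values whose coefficients are the even derivatives of \<open>f\<close> at \<open>0\<close> and \<open>\<pi>/2\<close>.
\<close>

section \<open>Truncated sums\<close>

text \<open>The monomial quasi-symmetric function with exponents \<open>w\<close> at the variables \<open>xs\<close>.\<close>

fun qsym :: "real list \<Rightarrow> nat list \<Rightarrow> real" where
  "qsym xs [] = 1"
| "qsym [] (k # w) = 0"
| "qsym (x # xs) (k # w) = x ^ k * qsym xs w + qsym xs (k # w)"

lemma sum_list_map_add:
  "(\<Sum>w\<leftarrow>ws. f w + g w :: real) = (\<Sum>w\<leftarrow>ws. f w) + (\<Sum>w\<leftarrow>ws. g w)"
  by (induction ws) auto

text \<open>Expanding both factors by whether they use the first variable gives four products. Three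
  of them match the three heads in the recursion of \<open>stuffle\<close>; the fourth leaves the
  variable out. All four are covered by the induction hypothesis on \<open>xs\<close>.\<close>

lemma qsym_stuffle: "qsym xs u * qsym xs v = (\<Sum>w\<leftarrow>stuffle u v. qsym xs w)"
proof (induction xs arbitrary: u v)
  case Nil
  show ?case by (induction u v rule: stuffle.induct) (simp_all add: comp_def)
next
  case (Cons x xs)
  show ?case
  proof (cases u; cases v)
    fix a u' b v' assume uv: "u = a # u'" "v = b # v'"
    have "(\<Sum>w\<leftarrow>stuffle u v. qsym (x # xs) w)
      = x ^ a * (\<Sum>w\<leftarrow>stuffle u' v. qsym xs w) + x ^ b * (\<Sum>w\<leftarrow>stuffle u v'. qsym xs w)
        + x ^ (a + b) * (\<Sum>w\<leftarrow>stuffle u' v'. qsym xs w) + (\<Sum>w\<leftarrow>stuffle u v. qsym xs w)"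
      by (simp add: uv comp_def sum_list_map_add sum_list_const_mult)
    also have "\<dots> = x ^ a * (qsym xs u' * qsym xs v) + x ^ b * (qsym xs u * qsym xs v')
        + x ^ (a + b) * (qsym xs u' * qsym xs v') + qsym xs u * qsym xs v"
      by (simp only: Cons.IH)
    also have "\<dots> = qsym (x # xs) u * qsym (x # xs) v"
      by (simp add: uv algebra_simps power_add)
    finally show ?thesis by simp
  qed auto
qed

text \<open>The recursion of \<open>qsym\<close> peels off the first variable, whereas raising the
  truncation adds a last one.\<close>

lemma qsym_snoc: "qsym (xs @ [y]) (w @ [k]) = qsym xs (w @ [k]) + qsym xs w * y ^ k"
proof (induction xs arbitrary: w)
  case Nil
  show ?case by (cases w; cases "tl w") auto
next
  case (Cons x xs)
  show ?case
  proof (cases w)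
    case Nil
    then show ?thesis using Cons.IH[of "[]"] by simp
  next
    case (Cons a v)
    then show ?thesis using Cons.IH[of v] Cons.IH[of w] by (simp add: algebra_simps)
  qed
qed

lemma qsym_nonneg: "\<forall>x\<in>set xs. 0 \<le> x \<Longrightarrow> 0 \<le> qsym xs w"
  by (induction xs w rule: qsym.induct) auto

text \<open>For variables in [0, 1] every positive exponent may be lowered to 1, and the resulting
  monomials all occur in the expanded power of the sum.\<close>

lemma qsym_le_power:
  assumes "\<forall>x\<in>set xs. 0 \<le> x \<and> x \<le> 1" "is_index w"
  shows "qsym xs w \<le> sum_list xs ^ length w"
  using assms
proof (induction xs w rule: qsym.induct)
  case (3 x xs k w)
  let ?s = "sum_list xs" and ?d = "length w"
  have s: "0 \<le> ?s" using 3 by (intro sum_list_nonneg) auto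
  have "x ^ k \<le> x ^ 1" using 3 by (intro power_decreasing) (auto simp: is_index_def)
  then have "x ^ k * qsym xs w \<le> x * ?s ^ ?d"
    using 3 qsym_nonneg[of xs w] by (intro mult_mono) (auto simp: is_index_def)
  then have "qsym (x # xs) (k # w) \<le> x * ?s ^ ?d + ?s ^ Suc ?d"
    using 3 by (auto intro: add_mono)
  also have "\<dots> = (x + ?s) * ?s ^ ?d" by (simp add: algebra_simps)
  also have "\<dots> \<le> (x + ?s) * (x + ?s) ^ ?d"
    using 3 s by (intro mult_left_mono power_mono) auto
  finally show ?case by simp
qed auto

definition tsum :: "nat \<Rightarrow> nat list \<Rightarrow> real" where
  "tsum N w = qsym (map (\<lambda>n. 1 / (2 * real n - 1)) [1..<Suc N]) w"

lemma tsum_Nil [simp]: "tsum N [] = 1"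
  by (simp add: tsum_def)

lemma tsum_0: "tsum 0 w = (if w = [] then 1 else 0)"
  by (cases w) (auto simp: tsum_def)

lemma tsum_Suc_snoc:
  "tsum (Suc N) (w @ [k]) = tsum N (w @ [k]) + tsum N w / (2 * real N + 1) ^ k"
proof -
  have "map (\<lambda>n. 1 / (2 * real n - 1)) [1..<Suc (Suc N)] =
      map (\<lambda>n. 1 / (2 * real n - 1)) [1..<Suc N] @ [1 / (2 * real N + 1)]"
    by simp
  then show ?thesis
    unfolding tsum_def by (simp only: qsym_snoc power_one_over) simp
qed

definition odd_harm :: "nat \<Rightarrow> real" where
  "odd_harm N = (\<Sum>n<N. 1 / (2 * real n + 1))"

lemma odd_harm_0 [simp]: "odd_harm 0 = 0"
  by (simp add: odd_harm_def)

lemma odd_harm_Suc: "odd_harm (Suc N) = odd_harm N + 1 / (2 * real N + 1)"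
  by (simp add: odd_harm_def)

lemma tsum_1 [simp]: "tsum N [Suc 0] = odd_harm N"
proof (induction N)
  case (Suc N)
  then show ?case using tsum_Suc_snoc[of N "[]" "Suc 0"] by (simp add: odd_harm_Suc)
qed (simp add: tsum_0)

lemma tsum_stuffle: "tsum N u * tsum N v = (\<Sum>w\<leftarrow>stuffle u v. tsum N w)"
  by (simp add: tsum_def qsym_stuffle)

lemma tsum_nonneg: "0 \<le> tsum N w"
  unfolding tsum_def by (intro qsym_nonneg) auto

lemma tsum_le_power:
  assumes "is_index w"
  shows "tsum N w \<le> odd_harm N ^ length w"
proof -
  let ?xs = "map (\<lambda>n. 1 / (2 * real n - 1)) [1..<Suc N]"
  have "sum_list xs = qsym xs [1]" for xs
    by (induction xs) auto
  then have "odd_harm N = sum_list ?xs" using tsum_1[of N] by (simp add: tsum_def)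
  moreover have "\<forall>x\<in>set ?xs. 0 \<le> x \<and> x \<le> 1"
    by auto
  ultimately show ?thesis
    using qsym_le_power[OF _ assms, of ?xs] by (simp add: tsum_def)
qed

lemma tsum_incseq: "incseq (\<lambda>N. tsum N w)"
proof (rule incseq_SucI)
  show "tsum N w \<le> tsum (Suc N) w" for N
    by (cases w rule: rev_cases) (auto simp: tsum_Suc_snoc tsum_nonneg)
qed

section \<open>Multiple t values as limits of truncated sums\<close>

definition increasing_lists :: "nat \<Rightarrow> nat \<Rightarrow> nat \<Rightarrow> nat list set" where
  "increasing_lists d M N = {ns. length ns = d \<and> sorted_wrt (<) ns \<and> set ns \<subseteq> {M..<N}}"

lemma finite_increasing_lists [simp]: "finite (increasing_lists d M N)"
  by (rule finite_subset[OF _ finite_lists_length_eq[of "{M..<N}" d]])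
    (auto simp: increasing_lists_def)

lemma increasing_lists_Suc:
  assumes "M < N"
  shows "increasing_lists (Suc d) M N =
    (#) M ` increasing_lists d (Suc M) N \<union> increasing_lists (Suc d) (Suc M) N" (is "?L = ?R")
proof (intro set_eqI iffI)
  fix ns assume ns: "ns \<in> ?L"
  then obtain m ms where [simp]: "ns = m # ms" 
    by (cases ns) (auto simp: increasing_lists_def)
  show "ns \<in> ?R"
  proof (cases "m = M")
    case True
    then show ?thesis using ns by (force simp: increasing_lists_def)
  next
    case False
    then show ?thesis using ns by (force simp: increasing_lists_def)
  qed
next
  fix ns assume "ns \<in> ?R"
  then show "ns \<in> ?L" using assms by (force simp: increasing_lists_def)
qed

lemma sum_increasing_lists:
  "(\<Sum>ns\<in>increasing_lists (length w) M N. \<Prod>i<length w. f (ns ! i) ^ (w ! i)) =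
    qsym (map f [M..<N]) w"
proof (induction "N - M" arbitrary: M w)
  case 0
  show ?case
  proof (cases w)
    case Nil
    have "increasing_lists 0 M N = {[]}" by (auto simp: increasing_lists_def)
    then show ?thesis using Nil by simp
  next
    case (Cons k v)
    have "increasing_lists (Suc (length v)) M N = {}"
      using 0 by (auto simp: increasing_lists_def length_Suc_conv)
    then show ?thesis using Cons 0 by simp
  qed
next
  case (Suc D)
  then have MN: "M < N" "D = N - Suc M" by auto
  show ?case
  proof (cases w)
    case Nil
    have "increasing_lists 0 M N = {[]}" by (auto simp: increasing_lists_def)
    then show ?thesis using Nil by simp
  next
    case (Cons k v)
    have disj: "(#) M ` increasing_lists (length v) (Suc M) N \<inter>
        increasing_lists (Suc (length v)) (Suc M) N = {}"
      by (auto simp: increasing_lists_def)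
    have "(\<Sum>ns\<in>increasing_lists (length w) M N. \<Prod>i<length w. f (ns ! i) ^ (w ! i)) =
      (\<Sum>ns\<in>increasing_lists (length v) (Suc M) N. f M ^ k * (\<Prod>i<length v. f (ns ! i) ^ (v ! i)))
      + (\<Sum>ns\<in>increasing_lists (length w) (Suc M) N. \<Prod>i<length w. f (ns ! i) ^ (w ! i))"
      unfolding Cons length_Cons increasing_lists_Suc[OF MN(1)]
      by (subst sum.union_disjoint[OF _ _ disj])
        (auto simp: sum.reindex prod.lessThan_Suc_shift simp del: prod.lessThan_Suc)
    also have "\<dots> = f M ^ k * qsym (map f [Suc M..<N]) v + qsym (map f [Suc M..<N]) w"
      using Suc(1)[OF MN(2)] by (simp add: sum_distrib_left [symmetric])
    also have "\<dots> = qsym (map f [M..<N]) w"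
      using MN by (simp add: Cons upt_rec[of M])
    finally show ?thesis .
  qed
qed

text \<open>The terms are nonnegative and their finite sums are bounded by the limit, so the family
  is summable. The truncations eventually contain every finite set of lists, hence the unordered sum
  can be computed along them.\<close>

lemma mtv_eqI:
  assumes "(\<lambda>N. tsum N w) \<longlonglongrightarrow> l"
  shows "mtv w = l"
proof -
  define A :: "nat list set" where "A = {ns. length ns = length w \<and> sorted_wrt (<) ns \<and> (\<forall>n\<in>set ns. 0 < n)}"
  define g where "g ns = (\<Prod>i<length w. 1 / (2 * real (ns ! i) - 1) ^ (w ! i))" for ns
  define B where "B N = increasing_lists (length w) 1 (Suc N)" for N
  have sum_B: "sum g (B N) = tsum N w" for N
    unfolding B_def g_def tsum_def sum_increasing_lists [symmetric] by (simp only: power_one_over)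
  have g_nonneg: "0 \<le> g ns" if "ns \<in> A" for ns
  proof -
    have "0 \<le> 1 / (2 * real (ns ! i) - 1) ^ (w ! i)" if "i < length w" for i
    proof -
      have "ns ! i \<in> set ns" using that \<open>ns \<in> A\<close> by (simp add: A_def)
      then have "0 < ns ! i" using \<open>ns \<in> A\<close> by (simp add: A_def)
      then show ?thesis by simp
    qed
    then show ?thesis unfolding g_def by (intro prod_nonneg) simp
  qed
  have B_sub: "B N \<subseteq> A" for N
    by (auto simp: A_def B_def increasing_lists_def)
  have cover: "\<exists>M. \<forall>N\<ge>M. F \<subseteq> B N" if F: "finite F" "F \<subseteq> A" for F
  proof (intro exI allI impI subsetI)
    \<comment> \<open>The cutoff is the largest entry occurring in \<open>F\<close>; the inserted 0
      keeps \<open>Max\<close> meaningful when there is none.\<close>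
    fix N ns assume N: "Max (insert 0 (\<Union>(set ` F))) \<le> N" and ns: "ns \<in> F"
    have "n \<le> N" if "n \<in> set ns" for n
    proof -
      have "n \<le> Max (insert 0 (\<Union>(set ` F)))"
        using F ns that by (intro Max_ge) auto
      then show ?thesis using N by simp
    qed
    moreover have "ns \<in> A" using ns F by blast
    ultimately show "ns \<in> B N"
      by (auto simp: A_def B_def increasing_lists_def Suc_le_eq less_Suc_eq_le)
  qed
  have le: "tsum N w \<le> l" for N
    using incseq_le[OF tsum_incseq assms] .
  have "g summable_on A"
  proof (rule nonneg_bdd_above_summable_on)
    show "bdd_above (sum g ` {F. F \<subseteq> A \<and> finite F})"
    proof (rule bdd_aboveI2)
      fix F assume "F \<in> {F. F \<subseteq> A \<and> finite F}"
      then have F: "finite F" "F \<subseteq> A" by auto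
      obtain N where "F \<subseteq> B N" using cover[OF F] by auto
      then have "sum g F \<le> sum g (B N)"
        using B_sub g_nonneg by (intro sum_mono2) (auto simp: B_def)
      then show "sum g F \<le> l" using le[of N] by (simp add: sum_B)
    qed
  qed (use g_nonneg in auto)
  then have "(sum g \<longlongrightarrow> infsum g A) (finite_subsets_at_top A)"
    using has_sum_infsum has_sum_def by blast
  moreover have "filterlim B (finite_subsets_at_top A) sequentially"
    unfolding filterlim_finite_subsets_at_top
  proof safe
    fix F assume "finite F" "F \<subseteq> A"
    then obtain M where "\<forall>N\<ge>M. F \<subseteq> B N" using cover by blast
    then show "\<forall>\<^sub>F N in sequentially. finite (B N) \<and> F \<subseteq> B N \<and> B N \<subseteq> A"
      using B_sub by (auto simp: eventually_sequentially B_def)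
  qed
  ultimately have "(\<lambda>N. sum g (B N)) \<longlonglongrightarrow> infsum g A"
    by (rule filterlim_compose)
  then have "(\<lambda>N. tsum N w) \<longlonglongrightarrow> infsum g A" by (simp add: sum_B)
  then have "infsum g A = l" using assms LIMSEQ_unique by blast
  then show ?thesis by (simp add: mtv_def A_def g_def[abs_def])
qed

section \<open>Sequences negligible against powers of the odd harmonic numbers\<close>

lemma odd_harm_nonneg [simp]: "0 \<le> odd_harm N"
  unfolding odd_harm_def by (intro sum_nonneg) auto

lemma odd_harm_le: "odd_harm N \<le> 1 + ln (real N + 1)"
proof (induction N)
  case (Suc N)
  \<comment> \<open>This comparison fails at N = 0; the summand 1 in the claimed bound pays for that
    first term.\<close>
  have "1 / (2 * real N + 1) \<le> ln (real N + 2) - ln (real N + 1)" if "N \<noteq> 0"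
  proof -
    have "ln ((real N + 1) / (real N + 2)) \<le> (real N + 1) / (real N + 2) - 1"
      by (intro ln_le_minus_one) auto
    also have "\<dots> = - (1 / (real N + 2))"
      by (simp add: field_simps)
    also have "\<dots> \<le> - (1 / (2 * real N + 1))"
      using that by (simp add: frac_le)
    finally show ?thesis
      by (simp add: ln_div)
  qed
  moreover have "0 \<le> ln (2 :: real)" by simp
  ultimately show ?case using Suc
    by (cases "N = 0") (auto simp: odd_harm_Suc add.commute)
qed simp

lemma odd_harm_ge: "ln (real N + 1) / 2 \<le> odd_harm N"
proof (induction N)
  case (Suc N)
  have "ln ((real N + 2) / (real N + 1)) \<le> (real N + 2) / (real N + 1) - 1"
    by (intro ln_le_minus_one) auto
  also have "\<dots> \<le> 2 * (1 / (2 * real N + 1))"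
    by (simp add: field_simps)
  finally have "ln (real N + 2) \<le> ln (real N + 1) + 2 * (1 / (2 * real N + 1))"
    by (simp add: ln_div)
  moreover have Suc_eq: "real (Suc N) + 1 = real N + 2" by simp
  ultimately show ?case using Suc unfolding odd_harm_Suc Suc_eq by linarith
qed simp

lemma odd_harm_at_top: "filterlim odd_harm at_top sequentially"
proof (rule filterlim_at_top_mono)
  show "filterlim (\<lambda>N. ln (real N + 1) / 2) at_top sequentially" by real_asymp
  show "\<forall>\<^sub>F N in sequentially. ln (real N + 1) / 2 \<le> odd_harm N"
    by (intro always_eventually allI odd_harm_ge)
qed

text \<open>Mere convergence to 0 would not survive multiplication by a polynomial in the unbounded
  \<open>odd_harm\<close>, which the product of two expansions requires.\<close>

definition odd_harm_negligible :: "(nat \<Rightarrow> real) \<Rightarrow> bool" where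
  "odd_harm_negligible e \<longleftrightarrow> (\<forall>j. (\<lambda>N. e N * odd_harm N ^ j) \<longlonglongrightarrow> 0)"

lemma odd_harm_power_over_sqrt: "(\<lambda>N. odd_harm N ^ j / sqrt (real N)) \<longlonglongrightarrow> 0"
proof (rule tendsto_sandwich[OF _ _ tendsto_const])
  show "(\<lambda>N. (1 + ln (real N + 1)) ^ j / sqrt (real N)) \<longlonglongrightarrow> 0"
    by real_asymp
  show "\<forall>\<^sub>F N in sequentially. 0 \<le> odd_harm N ^ j / sqrt (real N)"
    by simp
  show "\<forall>\<^sub>F N in sequentially. odd_harm N ^ j / sqrt (real N) \<le> (1 + ln (real N + 1)) ^ j / sqrt (real N)"
    by (intro always_eventually allI divide_right_mono power_mono odd_harm_le odd_harm_nonneg) simp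
qed

lemma tsum_over_N_tendsto_0:
  assumes "is_index w"
  shows "(\<lambda>N. tsum N w / real N) \<longlonglongrightarrow> 0"
proof (rule tendsto_sandwich[OF _ _ tendsto_const])
  have *: "(\<lambda>N. (odd_harm N ^ length w / sqrt (real N)) * (1 / sqrt (real N))) \<longlonglongrightarrow> 0 * 0"
    by (intro tendsto_mult odd_harm_power_over_sqrt) real_asymp
  show "(\<lambda>N. odd_harm N ^ length w / real N) \<longlonglongrightarrow> 0"
    using * by simp
  show "\<forall>\<^sub>F N in sequentially. tsum N w / real N \<le> odd_harm N ^ length w / real N"
    by (intro always_eventually allI divide_right_mono tsum_le_power assms) simp
qed (simp add: tsum_nonneg)

lemma negligible_of_sqrt_bound:
  assumes "\<And>N. N > 0 \<Longrightarrow> \<bar>e N\<bar> \<le> C / sqrt (real N)"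
  shows "odd_harm_negligible e"
  unfolding odd_harm_negligible_def
proof
  fix j
  show "(\<lambda>N. e N * odd_harm N ^ j) \<longlonglongrightarrow> 0"
  proof (rule Lim_null_comparison)
    have "\<bar>e N * odd_harm N ^ j\<bar> \<le> C * (odd_harm N ^ j / sqrt (real N))" if "N > 0" for N
      using mult_right_mono[OF assms[OF that], of "odd_harm N ^ j"]
      by (simp add: abs_mult)
    then show "\<forall>\<^sub>F N in sequentially. norm (e N * odd_harm N ^ j) \<le> C * (odd_harm N ^ j / sqrt (real N))"
      by (intro eventually_mono[OF eventually_gt_at_top[of 0]]) simp
    show "(\<lambda>N. C * (odd_harm N ^ j / sqrt (real N))) \<longlonglongrightarrow> 0"
      by (rule tendsto_mult_right_zero[OF odd_harm_power_over_sqrt])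
  qed
qed

lemma negligible_zero: "odd_harm_negligible (\<lambda>_. 0)"
  by (simp add: odd_harm_negligible_def)

lemma negligible_add:
  assumes "odd_harm_negligible e" "odd_harm_negligible f"
  shows "odd_harm_negligible (\<lambda>N. e N + f N)"
  using assms unfolding odd_harm_negligible_def
  by (auto simp: ring_distribs intro: tendsto_add_zero)

lemma negligible_cmult:
  assumes "odd_harm_negligible e"
  shows "odd_harm_negligible (\<lambda>N. c * e N)"
  using assms unfolding odd_harm_negligible_def
  by (auto simp: mult.assoc intro: tendsto_mult_right_zero)

lemma negligible_mult_odd_harm:
  assumes "odd_harm_negligible e"
  shows "odd_harm_negligible (\<lambda>N. e N * odd_harm N)"
  unfolding odd_harm_negligible_def
proof
  fix j
  have "(\<lambda>N. e N * odd_harm N ^ Suc j) \<longlonglongrightarrow> 0"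
    using assms unfolding odd_harm_negligible_def by blast
  then show "(\<lambda>N. e N * odd_harm N * odd_harm N ^ j) \<longlonglongrightarrow> 0"
    by (simp add: mult.assoc)
qed

lemma negligible_mult_poly:
  assumes "odd_harm_negligible e"
  shows "odd_harm_negligible (\<lambda>N. e N * poly p (odd_harm N))"
  using assms
proof (induction p arbitrary: e)
  case (pCons a p)
  have "odd_harm_negligible (\<lambda>N. a * e N + (e N * odd_harm N) * poly p (odd_harm N))"
    by (intro negligible_add negligible_cmult pCons.IH negligible_mult_odd_harm pCons.prems)
  then show ?case by (simp add: algebra_simps)
qed (simp add: negligible_zero)

lemma negligible_tendsto: "odd_harm_negligible e \<Longrightarrow> e \<longlonglongrightarrow> 0"
  unfolding odd_harm_negligible_def by (drule spec[of _ 0]) simp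

lemma negligible_mult:
  assumes "odd_harm_negligible e" "odd_harm_negligible f"
  shows "odd_harm_negligible (\<lambda>N. e N * f N)"
  unfolding odd_harm_negligible_def
proof
  fix j
  have "(\<lambda>N. e N * odd_harm N ^ j * f N) \<longlonglongrightarrow> 0 * 0"
    using assms negligible_tendsto unfolding odd_harm_negligible_def by (intro tendsto_mult) auto
  then show "(\<lambda>N. e N * f N * odd_harm N ^ j) \<longlonglongrightarrow> 0"
    by (simp add: ac_simps)
qed

lemma negligible_diff:
  assumes "odd_harm_negligible e" "odd_harm_negligible f"
  shows "odd_harm_negligible (\<lambda>N. e N - f N)"
  using negligible_add[OF assms(1) negligible_cmult[OF assms(2), of "-1"]] by simp

text \<open>A nonconstant polynomial tends to infinity along \<open>odd_harm\<close>, and a constant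
  equals its limit. Identities between truncated sums thereby become identities between
  polynomials.\<close>

lemma poly_odd_harm_eq_0:
  assumes "(\<lambda>N. poly p (odd_harm N)) \<longlonglongrightarrow> 0"
  shows "p = 0"
proof (cases "degree p = 0")
  case True
  then obtain c where "p = [:c:]" by (rule degree_eq_zeroE)
  then show ?thesis using assms LIMSEQ_unique[OF tendsto_const] by fastforce
next
  case False
  have "filterlim (\<lambda>N. poly p (odd_harm N)) at_infinity sequentially"
    using filterlim_poly_at_infinity[of p] False
      filterlim_compose[OF _ filterlim_at_top_imp_at_infinity[OF odd_harm_at_top]] by blast
  then have False
    by (rule not_tendsto_and_filterlim_at_infinity[OF sequentially_bot assms])
  then show ?thesis ..
qed

text \<open>Meant for s = sqrt N and t = sqrt (N + 1): a term of order N to the power -3/2 is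
  dominated by a telescoping difference.\<close>

lemma inverse_step_bound:
  fixes s t :: real
  assumes "0 < s" "s \<le> t" "t\<^sup>2 = s\<^sup>2 + 1"
  shows "1 / (s * t\<^sup>2) \<le> 2 * (1 / s - 1 / t)"
proof -
  have t: "0 < t" using assms by simp
  have "1 = (t - s) * (t + s)" using assms by (simp add: algebra_simps power2_eq_square)
  also have "\<dots> \<le> (t - s) * (2 * t)" using assms by (intro mult_left_mono) auto
  finally have "1 / (s * t\<^sup>2) \<le> (t - s) * (2 * t) / (s * t\<^sup>2)"
    using assms t by (intro divide_right_mono) auto
  also have "\<dots> = 2 * (1 / s - 1 / t)"
    using assms(1) t by (simp add: divide_simps power2_eq_square)
  finally show ?thesis .
qed

text \<open>All letters but the last contribute at most a power of a logarithm, hence at most C sqrt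
  N. As the last exponent is at least 2, increments telescope to a tail of order 1 / sqrt N, which
  beats every power of \<open>odd_harm\<close>.\<close>

lemma admissible_tsum:
  assumes "admissible w"
  shows "(\<lambda>N. tsum N w) \<longlonglongrightarrow> mtv w"
    and "odd_harm_negligible (\<lambda>N. tsum N w - mtv w)"
proof -
  have "\<exists>l. (\<lambda>N. tsum N w) \<longlonglongrightarrow> l \<and> odd_harm_negligible (\<lambda>N. tsum N w - l)"
  proof (cases w rule: rev_cases)
    case Nil
    then show ?thesis by (intro exI[of _ 1]) (simp add: negligible_zero)
  next
    case (snoc v k)
    have v: "is_index v" and k: "2 \<le> k"
      using assms by (auto simp: snoc admissible_def is_index_def)
    have "Bseq (\<lambda>N. odd_harm N ^ length v / sqrt (real N))"
      using odd_harm_power_over_sqrt[of "length v"] by (intro convergent_imp_Bseq) (auto simp: convergent_def)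
    then obtain C where C: "C > 0" "\<And>N. odd_harm N ^ length v / sqrt (real N) \<le> C"
      unfolding Bseq_def by force
    have step_le: "tsum (Suc N) w - tsum N w \<le> 2 * C / sqrt (real N) - 2 * C / sqrt (real (Suc N))"
      if "N > 0" for N
    proof -
      define s where "s = sqrt (real N)"
      define t where "t = sqrt (real (Suc N))"
      have st: "s\<^sup>2 = real N" "t\<^sup>2 = s\<^sup>2 + 1" "0 < s" "s \<le> t"
        using that by (simp_all add: s_def t_def)
      have "(2 * real N + 1) ^ 2 \<le> (2 * real N + 1) ^ k"
        using k by (intro power_increasing) auto
      then have "tsum (Suc N) w - tsum N w \<le> tsum N v / (2 * real N + 1) ^ 2"
        unfolding snoc tsum_Suc_snoc
        by (simp, intro divide_left_mono tsum_nonneg) auto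
      also have "\<dots> \<le> (C * s) / (2 * real N + 1) ^ 2"
        using tsum_le_power[OF v, of N] C(2)[of N] st
        by (intro divide_right_mono) (auto simp: field_simps simp flip: s_def)
      also have "\<dots> \<le> (C * s) / (s\<^sup>2 * t\<^sup>2)"
      proof (intro divide_left_mono)
        show "s\<^sup>2 * t\<^sup>2 \<le> (2 * real N + 1) ^ 2"
          unfolding st by (simp add: power2_eq_square algebra_simps)
        show "0 < (2 * real N + 1)\<^sup>2 * (s\<^sup>2 * t\<^sup>2)"
          using that st(3,4) by (intro mult_pos_pos zero_less_power) auto
      qed (use C st in auto)
      also have "\<dots> = C * (1 / (s * t\<^sup>2))"
        using st(3) by (simp add: power2_eq_square)
      also have "\<dots> \<le> C * (2 * (1 / s - 1 / t))"
        using C inverse_step_bound[OF st(3,4,2)] by (intro mult_left_mono) auto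
      finally show ?thesis by (simp add: s_def t_def algebra_simps)
    qed
    have bound: "tsum M w - tsum N w \<le> 2 * C / sqrt (real N)" if "N > 0" "N \<le> M" for N M
    proof -
      have "tsum M w - tsum N w \<le> 2 * C / sqrt (real N) - 2 * C / sqrt (real M)"
        using that(2)
      proof (induction M rule: dec_induct)
        case (step M)
        then show ?case using step_le[of M] that by linarith
      qed simp
      also have "\<dots> \<le> 2 * C / sqrt (real N)" using C by simp
      finally show ?thesis .
    qed
    have "tsum N w \<le> tsum 1 w + 2 * C" for N
      using bound[of 1 N] incseqD[OF tsum_incseq, of 0 1 w] C
      by (cases "N = 0") auto
    then obtain l where l: "(\<lambda>N. tsum N w) \<longlonglongrightarrow> l"
      using incseq_convergent[OF tsum_incseq] by blast
    have "odd_harm_negligible (\<lambda>N. tsum N w - l)"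
    proof (rule negligible_of_sqrt_bound)
      fix N :: nat assume N: "N > 0"
      have "l - tsum N w \<le> 2 * C / sqrt (real N)"
      proof (rule LIMSEQ_le_const2)
        show "(\<lambda>M. tsum M w - tsum N w) \<longlonglongrightarrow> l - tsum N w" by (intro tendsto_intros l)
        show "\<exists>k. \<forall>M\<ge>k. tsum M w - tsum N w \<le> 2 * C / sqrt (real N)" using bound[OF N] by blast
      qed
      moreover have "tsum N w \<le> l" by (rule incseq_le[OF tsum_incseq l])
      ultimately show "\<bar>tsum N w - l\<bar> \<le> 2 * C / sqrt (real N)" by simp
    qed
    then show ?thesis using l by blast
  qed
  then obtain l where l: "(\<lambda>N. tsum N w) \<longlonglongrightarrow> l" "odd_harm_negligible (\<lambda>N. tsum N w - l)"
    by blast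
  moreover have "mtv w = l" by (rule mtv_eqI[OF l(1)])
  ultimately show "(\<lambda>N. tsum N w) \<longlonglongrightarrow> mtv w" "odd_harm_negligible (\<lambda>N. tsum N w - mtv w)"
    by simp_all
qed

section \<open>Existence and uniqueness of the stuffle regularisation\<close>

lemma stuffle_Nil2 [simp]: "stuffle w [] = [w]"
  by (cases w) auto

lemma stuffle_is_index:
  "is_index u \<Longrightarrow> is_index v \<Longrightarrow> w \<in> set (stuffle u v) \<Longrightarrow> is_index w"
proof (induction u v arbitrary: w rule: stuffle.induct)
  case (3 a u b v)
  have idx: "is_index u" "is_index v" "is_index (a # u)" "is_index (b # v)" "1 \<le> a" "1 \<le> b"
    using 3(4,5) by (simp_all add: is_index_def)
  have Cons: "is_index (k # x)" if "1 \<le> k" "is_index x" for k x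
    using that by (simp add: is_index_def)
  from 3(6) consider x where "x \<in> set (stuffle u (b # v))" "w = a # x"
    | x where "x \<in> set (stuffle (a # u) v)" "w = b # x"
    | x where "x \<in> set (stuffle u v)" "w = (a + b) # x"
    by (simp only: stuffle.simps set_append set_map) blast
  then show ?case
  proof cases
    case x: 1
    show ?thesis unfolding x(2) by (rule Cons[OF idx(5) 3(1)[OF idx(1,4) x(1)]])
  next
    case x: 2
    show ?thesis unfolding x(2) by (rule Cons[OF idx(6) 3(2)[OF idx(3,2) x(1)]])
  next
    case x: 3
    show ?thesis unfolding x(2) by (rule Cons[OF trans_le_add1[OF idx(5)] 3(3)[OF idx(1,2) x(1)]])
  qed
qed simp_all

lemma index_eq_admissible_append_ones:
  assumes "is_index w"
  obtains u m where "admissible u" "w = u @ replicate m 1"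
proof -
  have "\<exists>u m. admissible u \<and> w = u @ replicate m 1"
    using assms
  proof (induction w rule: rev_induct)
    case Nil
    then show ?case by (simp add: admissible_def)
  next
    case (snoc k w)
    show ?case
    proof (cases "k = 1")
      case True
      have "is_index w" using snoc.prems by (simp add: is_index_def)
      then obtain u m where "admissible u" "w = u @ replicate m 1"
        using snoc.IH by blast
      then show ?thesis using True
        by (intro exI[of _ u] exI[of _ "Suc m"]) (simp add: replicate_append_same)
    next
      case False
      then have "admissible (w @ [k])" using snoc.prems by (auto simp: admissible_def is_index_def)
      then show ?thesis by (intro exI[of _ "w @ [k]"] exI[of _ 0]) simp
    qed
  qed
  then show ?thesis using that by blast
qed

text \<open>Inserting a 1 into a block of m trailing ones yields the same word m + 1 times; every
  other term ends in at most m ones after an admissible part. Quantifying over \<open>F\<close>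
  inside the existential expresses equality of formal sums, so one \<open>R\<close> serves every
  function on words. The nonemptiness clause keeps the prefix admissible when the induction prepends
  a letter that may be 1.\<close>

lemma sum_stuffle_1:
  assumes "admissible u"
  shows "\<exists>R. (\<forall>r\<in>set R. \<exists>u' j. admissible u' \<and> (u \<noteq> [] \<longrightarrow> u' \<noteq> []) \<and> j \<le> m \<and> r = u' @ replicate j 1) \<and>
    (\<forall>F :: nat list \<Rightarrow> real. (\<Sum>w\<leftarrow>stuffle (u @ replicate m 1) [1]. F w) =
      (real m + 1) * F (u @ replicate (Suc m) 1) + (\<Sum>r\<leftarrow>R. F r))"
  using assms
proof (induction u)
  case Nil
  show ?case
  proof (induction m)
    case 0
    show ?case by (intro exI[of _ "[]"]) simp
  next
    case (Suc m)
    then obtain R where R: "\<And>r. r \<in> set R \<Longrightarrow> \<exists>u' j. admissible u' \<and> j \<le> m \<and> r = u' @ replicate j 1"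
      "\<And>F :: nat list \<Rightarrow> real. (\<Sum>w\<leftarrow>stuffle (replicate m 1) [1]. F w) =
        (real m + 1) * F (replicate (Suc m) 1) + (\<Sum>r\<leftarrow>R. F r)"
      by auto
    show ?case
    proof (intro exI[of _ "map ((#) 1) R @ [2 # replicate m 1]"] conjI ballI allI)
      fix r assume "r \<in> set (map ((#) 1) R @ [2 # replicate m 1])"
      then consider r' where "r' \<in> set R" "r = 1 # r'" | "r = [2] @ replicate m 1" by auto
      then show "\<exists>u' j. admissible u' \<and> ([] \<noteq> [] \<longrightarrow> u' \<noteq> []) \<and> j \<le> Suc m \<and> r = u' @ replicate j 1"
      proof cases
        case 1
        then obtain u' j where u': "admissible u'" "j \<le> m" "r' = u' @ replicate j 1"
          using R by blast
        show ?thesis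
        \<comment> \<open>A 1 put before an empty admissible part lengthens the block of ones
          instead; the bound \<open>Suc m\<close> leaves room for it.\<close>
        proof (cases "u' = []")
          case True
          then show ?thesis using 1 u'
            by (intro exI[of _ "[]"] exI[of _ "Suc j"]) simp
        next
          case False
          then show ?thesis using 1 u'
            by (intro exI[of _ "1 # u'"] exI[of _ j]) (auto simp: admissible_def is_index_def)
        qed
      next
        case 2
        then show ?thesis
          by (intro exI[of _ "[2]"] exI[of _ m]) (auto simp: admissible_def is_index_def)
      qed
    next
      fix F :: "nat list \<Rightarrow> real"
      show "(\<Sum>w\<leftarrow>stuffle ([] @ replicate (Suc m) 1) [1]. F w) =
        (real (Suc m) + 1) * F ([] @ replicate (Suc (Suc m)) 1) +
        (\<Sum>r\<leftarrow>map ((#) 1) R @ [2 # replicate m 1]. F r)"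
        using R(2)[of "\<lambda>w. F (1 # w)"] by (simp add: comp_def algebra_simps numeral_2_eq_2)
    qed
  qed
next
  case (Cons a u)
  have u: "admissible u" using Cons.prems by (auto simp: admissible_def is_index_def split: if_splits)
  have a: "a \<ge> 1" "u = [] \<Longrightarrow> a \<ge> 2" using Cons.prems by (auto simp: admissible_def is_index_def)
  obtain R where R:
    "\<And>r. r \<in> set R \<Longrightarrow> \<exists>u' j. admissible u' \<and> (u \<noteq> [] \<longrightarrow> u' \<noteq> []) \<and> j \<le> m \<and> r = u' @ replicate j 1"
    "\<And>F :: nat list \<Rightarrow> real. (\<Sum>w\<leftarrow>stuffle (u @ replicate m 1) [1]. F w) =
      (real m + 1) * F (u @ replicate (Suc m) 1) + (\<Sum>r\<leftarrow>R. F r)"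
    using Cons.IH[OF u] by blast
  let ?R = "map ((#) a) R @ [(1 # a # u) @ replicate m 1, ((a + 1) # u) @ replicate m 1]"
  have new: "admissible (1 # a # u)" "admissible ((a + 1) # u)"
    using Cons.prems by (auto simp: admissible_def is_index_def)
  show ?case
  proof (intro exI[of _ ?R] conjI ballI allI)
    fix r assume "r \<in> set ?R"
    then consider r' where "r' \<in> set R" "r = a # r'" | "r = (1 # a # u) @ replicate m 1"
      | "r = ((a + 1) # u) @ replicate m 1" by auto
    then show "\<exists>u' j. admissible u' \<and> (a # u \<noteq> [] \<longrightarrow> u' \<noteq> []) \<and> j \<le> m \<and> r = u' @ replicate j 1"
    proof cases
      case 1
      then obtain u' j where u': "admissible u'" "u \<noteq> [] \<longrightarrow> u' \<noteq> []" "j \<le> m" "r' = u' @ replicate j 1"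
        using R by blast
      have "admissible (a # u')" using u' a by (auto simp: admissible_def is_index_def)
      then show ?thesis using 1 u' by (intro exI[of _ "a # u'"] exI[of _ j]) simp
    qed (use new in blast)+
  next
    fix F :: "nat list \<Rightarrow> real"
    show "(\<Sum>w\<leftarrow>stuffle ((a # u) @ replicate m 1) [1]. F w) =
      (real m + 1) * F ((a # u) @ replicate (Suc m) 1) + (\<Sum>r\<leftarrow>?R. F r)"
      using R(2)[of "\<lambda>w. F (a # w)"] by (simp add: comp_def)
  qed
qed

text \<open>The product with \<open>[1]\<close> can be solved for the word with one more trailing 1,
  because its coefficient m + 1 is nonzero. The other words have fewer trailing ones, so this is
  strong induction on their number. It drives both uniqueness and existence.\<close>

lemma index_stuffle_induct [consumes 1, case_names admissible step]:
  assumes "is_index w"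
    and adm: "\<And>w. admissible w \<Longrightarrow> P w"
    and step: "\<And>w R m. \<lbrakk>is_index w; P w; \<And>r. r \<in> set R \<Longrightarrow> P r;
      \<And>F :: nat list \<Rightarrow> real. (\<Sum>v\<leftarrow>stuffle w [1]. F v) = (real m + 1) * F (w @ [1]) + (\<Sum>r\<leftarrow>R. F r)\<rbrakk>
      \<Longrightarrow> P (w @ [1])"
  shows "P w"
proof -
  have "P (u @ replicate m 1)" if "admissible u" for u m
    using that
  proof (induction m arbitrary: u rule: less_induct)
    case (less m)
    show ?case
    proof (cases m)
      case 0
      then show ?thesis using less adm by simp
    next
      case (Suc n)
      from sum_stuffle_1[OF less.prems, of n] obtain R where
        R1: "\<forall>r\<in>set R. \<exists>u' j. admissible u' \<and> (u \<noteq> [] \<longrightarrow> u' \<noteq> []) \<and> j \<le> n \<and> r = u' @ replicate j 1"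
        and R2: "\<forall>F :: nat list \<Rightarrow> real. (\<Sum>w\<leftarrow>stuffle (u @ replicate n 1) [1]. F w) =
          (real n + 1) * F (u @ replicate (Suc n) 1) + (\<Sum>r\<leftarrow>R. F r)"
        by (elim exE conjE)
      have snoc: "u @ replicate (Suc n) 1 = (u @ replicate n 1) @ [1]"
        by (simp add: replicate_append_same)
      have "P ((u @ replicate n 1) @ [1])"
      proof (rule step)
        show "is_index (u @ replicate n 1)"
          using less.prems by (auto simp: admissible_def is_index_def)
        show "P (u @ replicate n 1)" using less Suc by simp
        show "P r" if r: "r \<in> set R" for r
        proof -
          obtain u' j where "admissible u'" "j \<le> n" "r = u' @ replicate j 1"
            using bspec[OF R1 r] by (elim exE conjE)
          then show ?thesis using less.IH[of j u'] Suc by simp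
        qed
        show "(\<Sum>v\<leftarrow>stuffle (u @ replicate n 1) [1]. F v) =
          (real n + 1) * F ((u @ replicate n 1) @ [1]) + (\<Sum>r\<leftarrow>R. F r)" for F :: "nat list \<Rightarrow> real"
          using spec[OF R2, of F] unfolding snoc .
      qed
      then show ?thesis unfolding Suc snoc .
    qed
  qed
  then show ?thesis using index_eq_admissible_append_ones[OF assms(1)] by blast
qed

lemma stuffle_reg_unique:
  assumes T: "is_stuffle_reg V T" and T': "is_stuffle_reg V T'"
  shows "T = T'"
proof
  fix w
  show "T w = T' w"
  proof (cases "is_index w")
    case True
    then show ?thesis
    proof (induction rule: index_stuffle_induct)
      case (admissible w)
      then show ?case using T T' by (simp add: is_stuffle_reg_def)
    next
      case (step w R m)
      have "is_index [1]" by (simp add: is_index_def)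
      then have "T w * T [1] = (\<Sum>v\<leftarrow>stuffle w [1]. T v)" "T' w * T' [1] = (\<Sum>v\<leftarrow>stuffle w [1]. T' v)"
        using step T T' unfolding is_stuffle_reg_def by blast+
      moreover have "(\<Sum>r\<leftarrow>R. T r) = (\<Sum>r\<leftarrow>R. T' r)"
        using step.IH by (intro arg_cong[of _ _ sum_list] map_cong) auto
      moreover have "T [1] = T' [1]" using T T' unfolding is_stuffle_reg_def by simp
      ultimately have "(real m + 1) * T (w @ [1]) = (real m + 1) * T' (w @ [1])"
        using step by simp
      then show ?case by (simp add: add_eq_0_iff)
    qed
  next
    case False
    then show ?thesis using T T' by (simp add: is_stuffle_reg_def)
  qed
qed

section \<open>Asymptotic polynomials in the odd harmonic numbers\<close>

definition asymptotic_poly :: "nat list \<Rightarrow> real poly \<Rightarrow> bool" where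
  "asymptotic_poly w p \<longleftrightarrow> odd_harm_negligible (\<lambda>N. tsum N w - poly p (odd_harm N))"

text \<open>The hypotheses differ in strength on purpose: the existence proof yields a negligible
  error, while an explicit evaluation only has to supply an error tending to 0.\<close>

lemma asymptotic_poly_unique:
  assumes "asymptotic_poly w p" "(\<lambda>N. tsum N w - poly q (odd_harm N)) \<longlonglongrightarrow> 0"
  shows "p = q"
proof -
  have "(\<lambda>N. (tsum N w - poly q (odd_harm N)) - (tsum N w - poly p (odd_harm N))) \<longlonglongrightarrow> 0 - 0"
    using assms(1) unfolding asymptotic_poly_def by (intro tendsto_diff[OF assms(2)] negligible_tendsto)
  then have "(\<lambda>N. poly (p - q) (odd_harm N)) \<longlonglongrightarrow> 0" by simp
  then show ?thesis using poly_odd_harm_eq_0 by fastforce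
qed

lemma asymptotic_poly_sum_list:
  assumes "\<And>w. w \<in> set ws \<Longrightarrow> asymptotic_poly w (P w)"
  shows "odd_harm_negligible (\<lambda>N. (\<Sum>w\<leftarrow>ws. tsum N w) - poly (\<Sum>w\<leftarrow>ws. P w) (odd_harm N))"
  using assms
proof (induction ws)
  case (Cons w ws)
  have "odd_harm_negligible (\<lambda>N. (tsum N w - poly (P w) (odd_harm N)) +
      ((\<Sum>w\<leftarrow>ws. tsum N w) - poly (\<Sum>w\<leftarrow>ws. P w) (odd_harm N)))"
    using Cons unfolding asymptotic_poly_def by (intro negligible_add) auto
  then show ?case by (simp add: algebra_simps)
qed (simp add: negligible_zero)

lemma asymptotic_poly_mult:
  assumes "asymptotic_poly u p" "asymptotic_poly v q"
  shows "odd_harm_negligible (\<lambda>N. tsum N u * tsum N v - poly (p * q) (odd_harm N))"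
proof -
  have "odd_harm_negligible (\<lambda>N. (tsum N u - poly p (odd_harm N)) * (tsum N v - poly q (odd_harm N)) +
    ((tsum N u - poly p (odd_harm N)) * poly q (odd_harm N) +
     (tsum N v - poly q (odd_harm N)) * poly p (odd_harm N)))"
    using assms unfolding asymptotic_poly_def
    by (intro negligible_add negligible_mult negligible_mult_poly)
  then show ?thesis by (simp add: algebra_simps)
qed

lemma asymptotic_poly_1: "asymptotic_poly [1] [:0, 1:]"
  by (simp add: asymptotic_poly_def negligible_zero)

lemma asymptotic_poly_exists:
  assumes "is_index w"
  shows "\<exists>p. asymptotic_poly w p"
  using assms
proof (induction rule: index_stuffle_induct)
  case (admissible w)
  then show ?case unfolding asymptotic_poly_def
    by (intro exI[of _ "[:mtv w:]"]) (simp add: admissible_tsum)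
next
  case (step w R m)
  obtain P where P: "\<And>r. r \<in> set R \<Longrightarrow> asymptotic_poly r (P r)" using step.IH by metis
  obtain p where p: "asymptotic_poly w p" using step.IH by blast
  define c where "c = 1 / (real m + 1)"
  have tsum_eq: "tsum N (w @ [1]) = c * (tsum N w * tsum N [1] - (\<Sum>r\<leftarrow>R. tsum N r))" for N
  proof -
    have "tsum N w * tsum N [1] = (real m + 1) * tsum N (w @ [1]) + (\<Sum>r\<leftarrow>R. tsum N r)"
      by (rule trans[OF tsum_stuffle step.hyps(2)])
    then show ?thesis by (simp only:) (simp add: c_def)
  qed
  have "odd_harm_negligible (\<lambda>N. c * ((tsum N w * tsum N [1] - poly (p * [:0, 1:]) (odd_harm N)) -
      ((\<Sum>r\<leftarrow>R. tsum N r) - poly (\<Sum>r\<leftarrow>R. P r) (odd_harm N))))"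
    by (intro negligible_cmult negligible_diff asymptotic_poly_mult p asymptotic_poly_1
        asymptotic_poly_sum_list P)
  moreover have alg: "c * (x - y - (s - q)) = c * (x - s) - c * (y - q)" for x y s q :: real
    by (simp add: algebra_simps)
  ultimately have "asymptotic_poly (w @ [1]) (smult c (p * [:0, 1:] - (\<Sum>r\<leftarrow>R. P r)))"
    unfolding asymptotic_poly_def tsum_eq poly_smult poly_diff alg by blast
  then show ?case by blast
qed

lemma poly_sum_list_map: "poly (\<Sum>w\<leftarrow>ws. P w) x = (\<Sum>w\<leftarrow>ws. poly (P w) x)"
  by (induction ws) auto

text \<open>The stuffle product is exact at each truncation, so it holds between the asymptotic
  polynomials and survives the substitution of \<open>V\<close>. This yields a regularisation, and
  uniqueness identifies it with \<open>mtv_stuffle V\<close>.\<close>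

theorem mtv_stuffle_eqI:
  assumes "is_index w" "(\<lambda>N. tsum N w - poly p (odd_harm N)) \<longlonglongrightarrow> 0"
  shows "mtv_stuffle V w = poly p V"
proof -
  define P where "P w = (SOME p. asymptotic_poly w p)" for w
  have P: "asymptotic_poly w (P w)" if "is_index w" for w
    unfolding P_def using asymptotic_poly_exists[OF that] by (rule someI_ex)
  have P_eqI: "P w = p" if "is_index w" "asymptotic_poly w p" for w p
    using asymptotic_poly_unique[OF P[OF that(1)]] that(2) negligible_tendsto
    unfolding asymptotic_poly_def by blast
  define T where "T w = (if is_index w then poly (P w) V else 0)" for w
  have "is_stuffle_reg V T"
    unfolding is_stuffle_reg_def
  proof (intro conjI allI impI)
    fix w assume w: "admissible w"
    then have "asymptotic_poly w [:mtv w:]" by (simp add: asymptotic_poly_def admissible_tsum)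
    then show "T w = mtv w" using w by (simp add: T_def admissible_def P_eqI)
  next
    have "is_index [1]" by (simp add: is_index_def)
    then show "T [1] = V" using P_eqI[OF _ asymptotic_poly_1] by (simp add: T_def)
  next
    fix w assume "\<not> is_index w"
    then show "T w = 0" by (simp add: T_def)
  next
    fix u v assume uv: "is_index u" "is_index v"
    have idx: "is_index w" if "w \<in> set (stuffle u v)" for w
      using stuffle_is_index[OF uv that] .
    have "odd_harm_negligible (\<lambda>N. (\<Sum>w\<leftarrow>stuffle u v. tsum N w) - poly (\<Sum>w\<leftarrow>stuffle u v. P w) (odd_harm N))"
      using idx by (intro asymptotic_poly_sum_list P)
    moreover have "odd_harm_negligible (\<lambda>N. tsum N u * tsum N v - poly (P u * P v) (odd_harm N))"
      using uv by (intro asymptotic_poly_mult P)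
    ultimately have "odd_harm_negligible (\<lambda>N.
      ((\<Sum>w\<leftarrow>stuffle u v. tsum N w) - poly (\<Sum>w\<leftarrow>stuffle u v. P w) (odd_harm N)) -
      (tsum N u * tsum N v - poly (P u * P v) (odd_harm N)))"
      by (rule negligible_diff)
    then have "(\<lambda>N. poly (P u * P v - (\<Sum>w\<leftarrow>stuffle u v. P w)) (odd_harm N)) \<longlonglongrightarrow> 0"
      by (intro negligible_tendsto) (simp add: tsum_stuffle)
    then have "P u * P v - (\<Sum>w\<leftarrow>stuffle u v. P w) = 0" by (rule poly_odd_harm_eq_0)
    then have "poly (P u) V * poly (P v) V = poly (\<Sum>w\<leftarrow>stuffle u v. P w) V"
      by (simp flip: poly_mult)
    also have "\<dots> = (\<Sum>w\<leftarrow>stuffle u v. poly (P w) V)"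
      by (rule poly_sum_list_map)
    also have "\<dots> = (\<Sum>w\<leftarrow>stuffle u v. T w)"
      using idx by (intro arg_cong[of _ _ sum_list] map_cong) (auto simp: T_def)
    finally show "T u * T v = (\<Sum>w\<leftarrow>stuffle u v. T w)" using uv by (simp add: T_def)
  qed
  then have "mtv_stuffle V = T"
    unfolding mtv_stuffle_def using stuffle_reg_unique by blast
  moreover have "P w = p" using asymptotic_poly_unique[OF P[OF assms(1)] assms(2)] .
  ultimately show ?thesis using assms(1) by (simp add: T_def)
qed

section \<open>Tail sums as moments of powers of the cosine\<close>

text \<open>Divided powers: with this normalisation differentiation lowers the index without
  producing a factor.\<close>

definition divpow :: "nat \<Rightarrow> real \<Rightarrow> real" where
  "divpow n x = x ^ n / fact n"

lemma divpow_0 [simp]: "divpow 0 x = 1"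
  by (simp add: divpow_def)

lemma divpow_at_0 [simp]: "divpow (Suc n) 0 = 0"
  by (simp add: divpow_def)

lemma divpow_nonneg: "0 \<le> x \<Longrightarrow> 0 \<le> divpow n x"
  by (simp add: divpow_def)

lemma has_real_derivative_divpow [derivative_intros]:
  assumes "(f has_real_derivative f') (at x within S)"
  shows "((\<lambda>x. divpow (Suc n) (f x)) has_real_derivative divpow n (f x) * f') (at x within S)"
proof -
  have "((\<lambda>x. f x ^ Suc n / fact (Suc n)) has_real_derivative
      (1 + real n) * (f' * f x ^ n) / fact (Suc n)) (at x within S)"
    by (intro DERIV_cdivide DERIV_power_Suc assms)
  also have "(1 + real n) * (f' * f x ^ n) / fact (Suc n) = divpow n (f x) * f'"
  proof -
    have fact_eq: "fact (Suc n) = (1 + real n) * fact n" by simp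
    have "1 + real n \<noteq> 0" by linarith
    then show ?thesis unfolding fact_eq divpow_def by simp
  qed
  finally show ?thesis by (simp only: divpow_def)
qed

lemma continuous_on_divpow [continuous_intros]:
  "continuous_on S f \<Longrightarrow> continuous_on S (\<lambda>x. divpow n (f x))"
  unfolding divpow_def by (intro continuous_on_divide continuous_on_power continuous_on_const) simp_all

text \<open>The central binomial coefficient of 2n over 4^n, which is also the reciprocal of 2n + 1
  times the integral of cos^(2n+1) over [0, pi/2].\<close>

fun wallis :: "nat \<Rightarrow> real" where
  "wallis 0 = 1"
| "wallis (Suc n) = wallis n * (2 * real n + 1) / (2 * real n + 2)"

lemma wallis_pos: "0 < wallis n"
proof (induction n)
  case (Suc n)
  then show ?case unfolding wallis.simps
    by (intro divide_pos_pos mult_pos_pos) simp_all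
qed simp

lemma wallis_le_1: "wallis n \<le> 1"
proof (induction n)
  case (Suc n)
  have "wallis n * (2 * real n + 1) \<le> 1 * (2 * real n + 2)"
    using Suc by (intro mult_mono) auto
  then show ?case by (simp add: field_simps)
qed simp

lemma has_integral_0_pi_half:
  fixes F :: "real \<Rightarrow> real"
  assumes "\<And>x. (F has_real_derivative f x) (at x)"
  shows "(f has_integral F (pi / 2) - F 0) {0..pi / 2}"
proof (rule fundamental_theorem_of_calculus)
  show "(F has_vector_derivative f x) (at x within {0..pi / 2})" for x
    using has_field_derivative_at_within[OF assms]
    unfolding has_real_derivative_iff_has_vector_derivative .
qed simp

definition cos_moment :: "nat \<Rightarrow> nat \<Rightarrow> real" where
  "cos_moment p b = integral {0..pi / 2} (\<lambda>x. cos x ^ p * divpow b x)"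

lemma has_integral_cos_moment:
  "((\<lambda>x. cos x ^ p * divpow b x) has_integral cos_moment p b) {0..pi / 2}"
  unfolding cos_moment_def
  by (intro integrable_integral integrable_continuous_interval continuous_intros)

lemma cos_moment_nonneg: "0 \<le> cos_moment p b"
  using has_integral_cos_moment
  by (rule has_integral_nonneg) (auto intro!: mult_nonneg_nonneg zero_le_power cos_ge_zero divpow_nonneg)

text \<open>The factor 2n neutralises the truncated subtraction in the exponent at n = 0.\<close>

lemma cos_power_eq:
  fixes x :: real
  shows "2 * real n * (sin x ^ 2 * cos x ^ (2 * n - 1)) =
    2 * real n * cos x ^ (2 * n - 1) - 2 * real n * cos x ^ (2 * n + 1)"
proof (cases n)
  case (Suc m)
  have "sin x ^ 2 = 1 - cos x ^ 2" by (simp add: sin_squared_eq)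
  then show ?thesis using Suc by (simp only:) (simp add: algebra_simps power2_eq_square)
qed simp

text \<open>Two integrations by parts: \<open>H\<close> is f' g - f g' for f = cos^(2n+1) and g the
  divided power of index 2b + 2, so its derivative is f'' g - f g''. It vanishes at 0, and at pi/2
  only n = 0 leaves a boundary term.\<close>

lemma cos_moment_recurrence:
  "2 * real n * (2 * real n + 1) * cos_moment (2 * n - 1) (2 * b + 2) =
    (2 * real n + 1) ^ 2 * cos_moment (2 * n + 1) (2 * b + 2) + cos_moment (2 * n + 1) (2 * b)
    - (if n = 0 then divpow (2 * b + 2) (pi / 2) else 0)"
proof -
  let ?p = "2 * real n + 1"
  define H where "H x = - ?p * (cos x ^ (2 * n) * sin x) * divpow (Suc (Suc (2 * b))) x
    - cos x ^ (2 * n + 1) * divpow (Suc (2 * b)) x" for x :: real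
  define h where "h x = 2 * real n * ?p * (cos x ^ (2 * n - 1) * divpow (2 * b + 2) x)
    - ?p ^ 2 * (cos x ^ (2 * n + 1) * divpow (2 * b + 2) x) - cos x ^ (2 * n + 1) * divpow (2 * b) x"
    for x :: real
  have "(H has_real_derivative h x) (at x)" for x
  proof -
    have "(H has_real_derivative
      ?p * (2 * real n * (sin x ^ 2 * cos x ^ (2 * n - 1))) * divpow (2 * b + 2) x
      - ?p * (cos x ^ (2 * n + 1)) * divpow (2 * b + 2) x - cos x ^ (2 * n + 1) * divpow (2 * b) x) (at x)"
      unfolding H_def
      by (rule derivative_eq_intros refl | simp add: algebra_simps power2_eq_square)+
    also have "?p * (2 * real n * (sin x ^ 2 * cos x ^ (2 * n - 1))) * divpow (2 * b + 2) x
      - ?p * (cos x ^ (2 * n + 1)) * divpow (2 * b + 2) x - cos x ^ (2 * n + 1) * divpow (2 * b) x = h x"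
      unfolding h_def cos_power_eq by (simp add: algebra_simps power2_eq_square)
    finally show ?thesis .
  qed
  then have "(h has_integral H (pi / 2) - H 0) {0..pi / 2}"
    by (rule has_integral_0_pi_half)
  moreover have "(h has_integral 2 * real n * ?p * cos_moment (2 * n - 1) (2 * b + 2)
    - ?p ^ 2 * cos_moment (2 * n + 1) (2 * b + 2) - cos_moment (2 * n + 1) (2 * b)) {0..pi / 2}"
    unfolding h_def
    by (intro has_integral_diff has_integral_mult_right has_integral_cos_moment)
  ultimately have "H (pi / 2) - H 0 = 2 * real n * ?p * cos_moment (2 * n - 1) (2 * b + 2)
    - ?p ^ 2 * cos_moment (2 * n + 1) (2 * b + 2) - cos_moment (2 * n + 1) (2 * b)"
    by (rule has_integral_unique)
  moreover have "H (pi / 2) - H 0 = - (if n = 0 then divpow (2 * b + 2) (pi / 2) else 0)"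
    by (simp add: H_def)
  ultimately show ?thesis by linarith
qed

lemma cos_moment_0_recurrence:
  "(2 * real n + 1) * cos_moment (2 * n + 1) 0 =
    2 * real n * cos_moment (2 * n - 1) 0 + (if n = 0 then 1 else 0)"
proof -
  define H where "H x = cos x ^ (2 * n) * sin x" for x :: real
  define h where "h x = (2 * real n + 1) * (cos x ^ (2 * n + 1) * divpow 0 x)
    - 2 * real n * (cos x ^ (2 * n - 1) * divpow 0 x)" for x :: real
  have "(H has_real_derivative h x) (at x)" for x
  proof -
    have "(H has_real_derivative cos x ^ (2 * n + 1) - 2 * real n * (sin x ^ 2 * cos x ^ (2 * n - 1))) (at x)"
      unfolding H_def
      by (rule derivative_eq_intros refl | simp add: algebra_simps power2_eq_square)+
    also have "cos x ^ (2 * n + 1) - 2 * real n * (sin x ^ 2 * cos x ^ (2 * n - 1)) = h x"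
      unfolding h_def cos_power_eq by (simp add: algebra_simps)
    finally show ?thesis .
  qed
  then have "(h has_integral H (pi / 2) - H 0) {0..pi / 2}"
    by (rule has_integral_0_pi_half)
  moreover have "(h has_integral (2 * real n + 1) * cos_moment (2 * n + 1) 0
    - 2 * real n * cos_moment (2 * n - 1) 0) {0..pi / 2}"
    unfolding h_def
    by (intro has_integral_diff has_integral_mult_right has_integral_cos_moment)
  ultimately have "H (pi / 2) - H 0 =
    (2 * real n + 1) * cos_moment (2 * n + 1) 0 - 2 * real n * cos_moment (2 * n - 1) 0"
    by (rule has_integral_unique)
  moreover have "H (pi / 2) - H 0 = (if n = 0 then 1 else 0)" by (simp add: H_def)
  ultimately show ?thesis by linarith
qed

text \<open>\<open>two_tail N b\<close> is the sum of \<open>\<Prod>i. 1 / (2 * n\<^sub>i - 1)\<^sup>2\<close> over \<open>N < n\<^sub>1 < \<dots> < n\<^sub>b\<close>,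
  as \<open>two_tail_Suc\<close> and the decay in \<open>N\<close> show.\<close>

fun two_tail :: "nat \<Rightarrow> nat \<Rightarrow> real" where
  "two_tail 0 b = divpow (2 * b) (pi / 2)"
| "two_tail (Suc n) b = (2 * real n + 1) * wallis n * cos_moment (2 * n + 1) (2 * b)"

lemma two_tail_nonneg: "0 \<le> two_tail N b"
  by (cases N) (auto simp: divpow_nonneg cos_moment_nonneg less_imp_le[OF wallis_pos])

lemma two_tail_0 [simp]: "two_tail N 0 = 1"
proof (cases N)
  case (Suc n)
  have "(2 * real n + 1) * wallis n * cos_moment (2 * n + 1) 0 = 1"
  proof (induction n)
    case 0
    show ?case using cos_moment_0_recurrence[of 0] by simp
  next
    case (Suc n)
    have rec: "(2 * real (Suc n) + 1) * cos_moment (2 * Suc n + 1) 0 = (2 * real n + 2) * cos_moment (2 * n + 1) 0"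
      using cos_moment_0_recurrence[of "Suc n"] by simp
    have "(2 * real (Suc n) + 1) * wallis (Suc n) * cos_moment (2 * Suc n + 1) 0 =
      wallis (Suc n) * ((2 * real (Suc n) + 1) * cos_moment (2 * Suc n + 1) 0)"
      by (simp only: ac_simps)
    also have "\<dots> = (2 * real n + 1) * wallis n * cos_moment (2 * n + 1) 0"
      unfolding rec by simp
    also note Suc.IH
    finally show ?case .
  qed
  then show ?thesis using Suc by simp
qed simp

text \<open>This is \<open>cos_moment_recurrence\<close> divided by 2n + 1: for n > 0 the factor 2n
  \<open>wallis n\<close> equals (2n - 1) \<open>wallis (n - 1)\<close>, the prefactor of
  \<open>two_tail n\<close>. For n = 0 the boundary term is \<open>two_tail 0\<close>.\<close>

lemma two_tail_Suc:
  "two_tail n (Suc b) = two_tail (Suc n) (Suc b) + two_tail (Suc n) b / (2 * real n + 1) ^ 2"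
proof (cases n)
  case 0
  then show ?thesis using cos_moment_recurrence[of 0 b] by simp
next
  case (Suc m)
  let ?p = "2 * real n + 1"
  let ?M = "cos_moment (2 * n + 1) (2 * b + 2)"
  let ?L = "cos_moment (2 * n + 1) (2 * b)"
  have rec: "2 * real n * ?p * cos_moment (2 * m + 1) (2 * b + 2) = ?p ^ 2 * ?M + ?L"
    using cos_moment_recurrence[of n b] Suc by simp
  have w: "wallis n * (2 * real n) = wallis m * (2 * real m + 1)"
    using Suc by (simp add: field_simps)
  have p: "?p > 0" by (simp add: add_nonneg_pos)
  have eq: "p * w * M + p * w * L / p ^ 2 = w * ((p ^ 2 * M + L) / p)" if "p \<noteq> 0" for p w M L :: real
    using that by (simp add: field_simps power2_eq_square)
  have "two_tail (Suc n) (Suc b) + two_tail (Suc n) b / ?p ^ 2 = wallis n * ((?p ^ 2 * ?M + ?L) / ?p)"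
    unfolding two_tail.simps using eq[of ?p] p by simp
  also have "\<dots> = (wallis n * (2 * real n)) * cos_moment (2 * m + 1) (2 * b + 2)"
    unfolding rec[symmetric] using p by simp
  also have "\<dots> = two_tail n (Suc b)"
    unfolding w using Suc by simp
  finally show ?thesis by simp
qed

text \<open>The inequality x \<le> tan x, cleared of its denominator so that pi/2 is
  included.\<close>

lemma mult_cos_le_sin:
  fixes x :: real
  assumes "0 \<le> x" "x \<le> pi / 2"
  shows "x * cos x \<le> sin x"
proof (cases "x = pi / 2")
  case False
  then have x: "\<bar>x\<bar> < pi / 2" using assms by simp
  have "0 < cos x" using assms x by (intro cos_gt_zero_pi) auto
  moreover have "0 \<le> tan x" using assms x by (cases "x = 0") (auto intro: less_imp_le[OF tan_gt_zero])
  ultimately show ?thesis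
    using abs_tan_ge[OF x] assms by (simp add: tan_def field_simps)
next
  case True
  show ?thesis unfolding True by simp
qed

text \<open>Comparing with \<open>b = 0\<close>: \<open>x\<^sup>2 cos\<^sup>2 x \<le> sin\<^sup>2 x\<close> trades two powers of \<open>x\<close> for the difference of consecutive
  moments, which is smaller by a factor \<open>1/(2n)\<close>.\<close>

lemma two_tail_le: "\<exists>C. \<forall>N\<ge>2. two_tail N (Suc b) \<le> C / real N"
proof (intro exI allI impI)
  fix N :: nat assume "2 \<le> N"
  then obtain n where n: "N = Suc n" "n > 0" by (cases N) auto
  let ?C = "(pi / 2) ^ (2 * b)"
  have le: "cos_moment (2 * n + 1) (2 * b + 2) \<le> ?C * (cos_moment (2 * n - 1) 0 - cos_moment (2 * n + 1) 0)"
  proof (rule has_integral_le[OF has_integral_cos_moment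
        has_integral_mult_right[OF has_integral_diff[OF has_integral_cos_moment has_integral_cos_moment]]])
    fix x :: real assume x: "x \<in> {0..pi / 2}"
    then have c: "0 \<le> cos x" by (intro cos_ge_zero) auto
    obtain m where m: "n = Suc m" using n by (cases n) auto
    have "divpow (2 * b + 2) x \<le> x ^ (2 * b + 2) / 1"
      unfolding divpow_def by (rule divide_left_mono[OF fact_ge_1]) (use x in simp_all)
    then have "cos x ^ (2 * n + 1) * divpow (2 * b + 2) x \<le> cos x ^ (2 * n + 1) * x ^ (2 * b + 2)"
      using c by (intro mult_left_mono) auto
    also have "\<dots> = x ^ (2 * b) * (cos x ^ (2 * n - 1) * (x * cos x) ^ 2)"
      by (simp add: m power_mult_distrib power2_eq_square)
    also have "\<dots> \<le> ?C * (cos x ^ (2 * n - 1) * sin x ^ 2)"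
      using x c mult_cos_le_sin[of x] by (intro mult_mono power_mono mult_nonneg_nonneg) auto
    also have "\<dots> = ?C * (cos x ^ (2 * n - 1) * divpow 0 x - cos x ^ (2 * n + 1) * divpow 0 x)"
    proof -
      have "sin x ^ 2 = 1 - cos x ^ 2" by (simp add: sin_squared_eq)
      then show ?thesis by (simp only: m) (simp add: algebra_simps power2_eq_square)
    qed
    finally show "cos x ^ (2 * n + 1) * divpow (2 * b + 2) x \<le>
      ?C * (cos x ^ (2 * n - 1) * divpow 0 x - cos x ^ (2 * n + 1) * divpow 0 x)" .
  qed
  have eq: "2 * real n * (cos_moment (2 * n - 1) 0 - cos_moment (2 * n + 1) 0) = cos_moment (2 * n + 1) 0"
    using cos_moment_0_recurrence[of n] n by (simp add: algebra_simps)
  have "2 * real n * cos_moment (2 * n + 1) (2 * b + 2) \<le>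
      2 * real n * (?C * (cos_moment (2 * n - 1) 0 - cos_moment (2 * n + 1) 0))"
    by (intro mult_left_mono le) simp
  also have "\<dots> = ?C * (2 * real n * (cos_moment (2 * n - 1) 0 - cos_moment (2 * n + 1) 0))"
    by (rule mult.left_commute)
  also have "\<dots> = ?C * cos_moment (2 * n + 1) 0"
    unfolding eq ..
  finally have "2 * real n * cos_moment (2 * n + 1) (2 * b + 2) \<le> ?C * cos_moment (2 * n + 1) 0" .
  then have "(2 * real n + 1) * wallis n * (2 * real n * cos_moment (2 * n + 1) (2 * b + 2)) \<le>
      (2 * real n + 1) * wallis n * (?C * cos_moment (2 * n + 1) 0)"
    using wallis_pos[of n] by (intro mult_left_mono) auto
  then have "2 * real n * two_tail N (Suc b) \<le> ?C * two_tail N 0"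
    unfolding n(1) two_tail.simps by (simp add: ac_simps del: two_tail_0)
  then have "two_tail N (Suc b) \<le> ?C / (2 * real n)"
    using n by (simp add: field_simps)
  also have "\<dots> \<le> ?C / real N"
    using n by (intro divide_left_mono) auto
  finally show "two_tail N (Suc b) \<le> ?C / real N" .
qed

section \<open>Splitting sums at the truncation point\<close>

lemma tsum_two_tail_tendsto_0:
  assumes "is_index w"
  shows "(\<lambda>N. tsum N w * two_tail N (Suc b)) \<longlonglongrightarrow> 0"
proof -
  obtain C where C: "\<And>N. N \<ge> 2 \<Longrightarrow> two_tail N (Suc b) \<le> C / real N" using two_tail_le by blast
  have "(\<lambda>N. C * (tsum N w / real N)) \<longlonglongrightarrow> 0"
    by (rule tendsto_mult_right_zero[OF tsum_over_N_tendsto_0[OF assms]])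
  moreover
  have "norm (tsum N w * two_tail N (Suc b)) \<le> C * (tsum N w / real N)" if "N \<ge> 2" for N
    using mult_left_mono[OF C[OF that] tsum_nonneg[of N w]]
    by (simp add: abs_mult tsum_nonneg two_tail_nonneg mult.commute)
  then have "\<forall>\<^sub>F N in sequentially. norm (tsum N w * two_tail N (Suc b)) \<le> C * (tsum N w / real N)"
    by (rule eventually_mono[OF eventually_ge_at_top])
  ultimately show ?thesis by (rule Lim_null_comparison[rotated])
qed

text \<open>In generating functions, f' = (1 + c X) f + d and k = (1 + c X) k', whence f' k' = f k +
  d k'. Raising the truncation by one moves the factor 1 + c X of a single variable from the tail to
  the truncated sum.\<close>

lemma convolution_shift:
  fixes f f' k k' :: "nat \<Rightarrow> real"
  assumes "f' 0 = f 0 + d" "\<And>i. f' (Suc i) = f (Suc i) + c * f i"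
    and "k 0 = k' 0" "\<And>i. k (Suc i) = k' (Suc i) + c * k' i"
  shows "(\<Sum>i\<le>b. f' i * k' (b - i)) = (\<Sum>i\<le>b. f i * k (b - i)) + d * k' b"
proof (cases b)
  case 0
  then show ?thesis using assms by (simp add: algebra_simps)
next
  case (Suc n)
  have "(\<Sum>i\<le>Suc n. f' i * k' (Suc n - i)) = f 0 * k' (Suc n) + d * k' (Suc n)
    + (\<Sum>i\<le>n. f (Suc i) * k' (n - i)) + c * (\<Sum>i\<le>n. f i * k' (n - i))"
    by (simp add: sum.atMost_Suc_shift assms algebra_simps sum.distrib sum_distrib_left del: sum.atMost_Suc)
  also have "\<dots> = (\<Sum>i\<le>Suc n. f i * k' (Suc n - i)) + c * (\<Sum>i\<le>n. f i * k' (n - i)) + d * k' (Suc n)"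
    by (simp add: sum.atMost_Suc_shift del: sum.atMost_Suc)
  also have "\<dots> = (\<Sum>i\<le>n. f i * (k' (Suc (n - i)) + c * k' (n - i))) + f (Suc n) * k' 0 + d * k' (Suc n)"
    by (simp add: Suc_diff_le algebra_simps sum.distrib sum_distrib_left)
  also have "\<dots> = (\<Sum>i\<le>Suc n. f i * k (Suc n - i)) + d * k' (Suc n)"
    by (simp add: Suc_diff_le assms)
  finally show ?thesis using Suc by simp
qed

lemma tsum_Suc_append_twos:
  "tsum (Suc N) (w @ replicate (Suc b) 2) =
    tsum N (w @ replicate (Suc b) 2) + 1 / (2 * real N + 1) ^ 2 * tsum N (w @ replicate b 2)"
  using tsum_Suc_snoc[of N "w @ replicate b 2" 2] by (simp add: replicate_append_same)

text \<open>Each summand has exactly i indices up to N and the rest beyond, so the total is the full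
  sum and does not depend on N. At N = 0 only i = 0 survives, which gives the value.\<close>

lemma sum_twos_two_tail:
  "(\<Sum>i\<le>b. tsum N (replicate i 2) * two_tail N (b - i)) = divpow (2 * b) (pi / 2)"
proof (induction N)
  case 0
  have "(\<Sum>i\<le>b. tsum 0 (replicate i 2) * two_tail 0 (b - i)) = (\<Sum>i\<in>{0}. two_tail 0 (b - i))"
    by (intro sum.mono_neutral_cong_right) (auto simp: tsum_0)
  then show ?case by simp
next
  case (Suc N)
  have "(\<Sum>i\<le>b. tsum (Suc N) (replicate i 2) * two_tail (Suc N) (b - i)) =
    (\<Sum>i\<le>b. tsum N (replicate i 2) * two_tail N (b - i)) + 0 * two_tail (Suc N) b"
  proof (rule convolution_shift[where c = "1 / (2 * real N + 1) ^ 2"])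
    show "tsum (Suc N) (replicate (Suc i) 2) =
      tsum N (replicate (Suc i) 2) + 1 / (2 * real N + 1) ^ 2 * tsum N (replicate i 2)" for i
      using tsum_Suc_append_twos[of N "[]" i] by simp
    show "two_tail N (Suc i) = two_tail (Suc N) (Suc i) + 1 / (2 * real N + 1) ^ 2 * two_tail (Suc N) i" for i
      unfolding two_tail_Suc[of N i] by simp
    show "two_tail N 0 = two_tail (Suc N) 0" by (simp del: two_tail.simps)
  qed simp
  then show ?case using Suc by simp
qed

text \<open>Two ways to organise the tuples whose middle index, the one with exponent 1, is at most
  N: by that index, which is n + 1 on the left, or by the number i of later indices that are still
  at most N.\<close>

lemma sum_two_one_two_tail:
  "(\<Sum>n<N. tsum n (replicate a 2) / (2 * real n + 1) * two_tail (Suc n) b) =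
    (\<Sum>i\<le>b. tsum N (replicate a 2 @ [1] @ replicate i 2) * two_tail N (b - i))"
proof (induction N)
  case 0
  show ?case by (simp add: tsum_0)
next
  case (Suc N)
  have "(\<Sum>i\<le>b. tsum (Suc N) (replicate a 2 @ [1] @ replicate i 2) * two_tail (Suc N) (b - i)) =
    (\<Sum>i\<le>b. tsum N (replicate a 2 @ [1] @ replicate i 2) * two_tail N (b - i))
    + tsum N (replicate a 2) / (2 * real N + 1) * two_tail (Suc N) b"
  proof (rule convolution_shift[where c = "1 / (2 * real N + 1) ^ 2"])
    show "tsum (Suc N) (replicate a 2 @ [1] @ replicate 0 2) =
      tsum N (replicate a 2 @ [1] @ replicate 0 2) + tsum N (replicate a 2) / (2 * real N + 1)"
      using tsum_Suc_snoc[of N "replicate a 2" 1] by simp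
    show "tsum (Suc N) (replicate a 2 @ [1] @ replicate (Suc i) 2) =
      tsum N (replicate a 2 @ [1] @ replicate (Suc i) 2) +
      1 / (2 * real N + 1) ^ 2 * tsum N (replicate a 2 @ [1] @ replicate i 2)" for i
      using tsum_Suc_append_twos[of N "replicate a 2 @ [1]" i] by simp
    show "two_tail N (Suc i) = two_tail (Suc N) (Suc i) + 1 / (2 * real N + 1) ^ 2 * two_tail (Suc N) i" for i
      unfolding two_tail_Suc[of N i] by simp
    show "two_tail N 0 = two_tail (Suc N) 0" by (simp del: two_tail.simps)
  qed
  then show ?case using Suc by simp
qed

text \<open>For i < b the tail is nonempty and of order 1/N, which outweighs the polylogarithmic
  growth of the truncated sum. The term i = b has tail 1.\<close>

lemma tendsto_last_of_convolution:
  assumes "\<And>i. is_index (w i)"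
  shows "(\<lambda>N. (\<Sum>i\<le>b. tsum N (w i) * two_tail N (b - i)) - tsum N (w b)) \<longlonglongrightarrow> 0"
proof -
  have "(\<Sum>i\<le>b. tsum N (w i) * two_tail N (b - i)) - tsum N (w b) =
      (\<Sum>i<b. tsum N (w i) * two_tail N (Suc (b - Suc i)))" for N
    by (simp add: lessThan_Suc_atMost[symmetric] Suc_diff_Suc del: two_tail.simps)
  moreover have "(\<lambda>N. \<Sum>i<b. tsum N (w i) * two_tail N (Suc (b - Suc i))) \<longlonglongrightarrow> (\<Sum>i<b. 0)"
    by (intro tendsto_sum tsum_two_tail_tendsto_0 assms)
  ultimately show ?thesis by simp
qed

lemma mtv_twos: "mtv (replicate b 2) = divpow (2 * b) (pi / 2)"
proof (rule mtv_eqI)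
  have "(\<lambda>N. (\<Sum>i\<le>b. tsum N (replicate i 2) * two_tail N (b - i)) - tsum N (replicate b 2)) \<longlonglongrightarrow> 0"
    by (intro tendsto_last_of_convolution) (simp add: is_index_def)
  then have "(\<lambda>N. divpow (2 * b) (pi / 2) - (divpow (2 * b) (pi / 2) - tsum N (replicate b 2))) \<longlonglongrightarrow>
      divpow (2 * b) (pi / 2) - 0"
    unfolding sum_twos_two_tail by (intro tendsto_diff tendsto_const)
  then show "(\<lambda>N. tsum N (replicate b 2)) \<longlonglongrightarrow> divpow (2 * b) (pi / 2)" by simp
qed

lemma tsum_twos_le: "tsum N (replicate b 2) \<le> divpow (2 * b) (pi / 2)"
proof -
  have "tsum N (replicate b 2) * two_tail N (b - b) \<le> (\<Sum>i\<le>b. tsum N (replicate i 2) * two_tail N (b - i))"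
    by (intro member_le_sum) (auto simp: tsum_nonneg two_tail_nonneg)
  then show ?thesis unfolding sum_twos_two_tail by simp
qed

section \<open>Truncated sums as power series coefficients\<close>

text \<open>The coefficients of the divided power of index 2a of y, divided by cos y, in powers of
  sin^2 y; see \<open>cos_one_series\<close>.\<close>

definition one_coeff :: "nat \<Rightarrow> nat \<Rightarrow> real" where
  "one_coeff a n = wallis n * tsum n (replicate a 2)"

lemma one_coeff_nonneg: "0 \<le> one_coeff a n"
  unfolding one_coeff_def by (intro mult_nonneg_nonneg less_imp_le[OF wallis_pos] tsum_nonneg)

lemma one_coeff_le: "one_coeff a n \<le> divpow (2 * a) (pi / 2)"
proof -
  have "one_coeff a n \<le> 1 * divpow (2 * a) (pi / 2)"
    unfolding one_coeff_def by (intro mult_mono wallis_le_1 tsum_twos_le tsum_nonneg) simp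
  then show ?thesis by simp
qed

lemma summable_one_coeff:
  fixes u :: real
  assumes "norm u < 1"
  shows "summable (\<lambda>n. one_coeff a n * u ^ n)"
    and "summable (\<lambda>n. one_coeff a n / (2 * real n + 1) * u ^ n)"
proof -
  let ?C = "divpow (2 * a) (pi / 2)"
  have g: "summable (\<lambda>n. ?C * norm u ^ n)"
    using assms by (intro summable_mult summable_geometric) simp
  show "summable (\<lambda>n. one_coeff a n * u ^ n)"
  proof (rule summable_comparison_test'[OF g])
    fix n
    show "norm (one_coeff a n * u ^ n) \<le> ?C * norm u ^ n"
      by (simp add: abs_mult power_abs one_coeff_nonneg one_coeff_le mult_right_mono)
  qed
  show "summable (\<lambda>n. one_coeff a n / (2 * real n + 1) * u ^ n)"
  proof (rule summable_comparison_test'[OF g])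
    fix n
    have "one_coeff a n / (2 * real n + 1) \<le> one_coeff a n / 1"
      by (intro divide_left_mono one_coeff_nonneg) simp_all
    also have "\<dots> \<le> ?C" using one_coeff_le by simp
    finally have "one_coeff a n / (2 * real n + 1) * norm u ^ n \<le> ?C * norm u ^ n"
      by (rule mult_right_mono) simp
    then show "norm (one_coeff a n / (2 * real n + 1) * u ^ n) \<le> ?C * norm u ^ n"
      by (simp add: abs_mult one_coeff_nonneg power_abs)
  qed
qed

lemma diffs_sums:
  fixes c :: "nat \<Rightarrow> real"
  assumes "\<And>u :: real. norm u < 1 \<Longrightarrow> summable (\<lambda>n. c n * u ^ n)" and "norm u < 1"
  shows "(\<lambda>n. diffs c n * u ^ n) sums (\<Sum>n. diffs c n * u ^ n)"
    and "(\<lambda>n. real n * c n * u ^ n) sums (u * (\<Sum>n. diffs c n * u ^ n))"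
proof -
  have s: "summable (\<lambda>n. diffs c n * u ^ n)"
    using assms by (intro termdiff_converges[of u 1]) simp_all
  then show "(\<lambda>n. diffs c n * u ^ n) sums (\<Sum>n. diffs c n * u ^ n)"
    by (rule summable_sums)
  have "(\<lambda>n. u * (real n * c n * u ^ (n - Suc 0))) sums (u * (\<Sum>n. diffs c n * u ^ n))"
    by (intro sums_mult diffs_equiv[OF s])
  moreover have "u * (real n * c n * u ^ (n - Suc 0)) = real n * c n * u ^ n" for n
    by (cases n) (simp_all add: ac_simps)
  ultimately show "(\<lambda>n. real n * c n * u ^ n) sums (u * (\<Sum>n. diffs c n * u ^ n))"
    by simp
qed

definition one_series :: "nat \<Rightarrow> real \<Rightarrow> real" where
  "one_series a u = (\<Sum>n. one_coeff a n * u ^ n)"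

definition one_series_int :: "nat \<Rightarrow> real \<Rightarrow> real" where
  "one_series_int a u = (\<Sum>n. one_coeff a n / (2 * real n + 1) * u ^ n)"

lemma one_series_sums:
  "norm u < 1 \<Longrightarrow> (\<lambda>n. one_coeff a n * u ^ n) sums one_series a u"
  "norm u < 1 \<Longrightarrow> (\<lambda>n. one_coeff a n / (2 * real n + 1) * u ^ n) sums one_series_int a u"
  unfolding one_series_def one_series_int_def
  by (intro summable_sums summable_one_coeff; assumption)+

text \<open>With \<open>u = sin\<^sup>2 x\<close>, the next identities say that \<open>cos x * one_series a u\<close> is the derivative of
  \<open>sin x * one_series_int a u\<close>, which in turn is the derivative of \<open>cos x * one_series (a + 1) u\<close>.\<close>

lemma one_series_int_deriv:
  assumes "norm u < 1"
  obtains D where "(one_series_int a has_real_derivative D) (at u)"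
    "one_series_int a u + 2 * u * D = one_series a u"
proof
  let ?c = "\<lambda>n. one_coeff a n / (2 * real n + 1)"
  let ?D = "\<Sum>n. diffs ?c n * u ^ n"
  show "(one_series_int a has_real_derivative ?D) (at u)"
    unfolding one_series_int_def[abs_def]
    by (rule termdiffs_strong'[OF summable_one_coeff(2) assms])
  have "(\<lambda>n. ?c n * u ^ n + 2 * (real n * ?c n * u ^ n)) sums
      (one_series_int a u + 2 * (u * ?D))"
    by (intro sums_add sums_mult one_series_sums diffs_sums(2) summable_one_coeff(2) assms)
  moreover have "?c n * u ^ n + 2 * (real n * ?c n * u ^ n) = one_coeff a n * u ^ n" for n
  proof -
    have "?c n * u ^ n + 2 * (real n * ?c n * u ^ n) = ((2 * real n + 1) * ?c n) * u ^ n"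
      by (simp only: algebra_simps)
    also have "(2 * real n + 1) * ?c n = one_coeff a n"
      by (simp add: add_nonneg_eq_0_iff)
    finally show ?thesis .
  qed
  ultimately have "(\<lambda>n. one_coeff a n * u ^ n) sums (one_series_int a u + 2 * (u * ?D))"
    by simp
  from sums_unique2[OF this one_series_sums(1)[OF assms]]
  show "one_series_int a u + 2 * u * ?D = one_series a u" by simp
qed

text \<open>The recursion of \<open>wallis\<close> turns the left side into a multiple of the
  increment of the truncated sum from n to n + 1, which splits off a last exponent 2. In
  coefficients this is the differential equation in \<open>one_series_deriv\<close>.\<close>

lemma one_coeff_recurrence:
  "2 * diffs (one_coeff a) n - (2 * real n + 1) * one_coeff a n =
    (if a = 0 then 0 else one_coeff (a - 1) n / (2 * real n + 1))"
proof -
  have w: "2 * (real n + 1) * wallis (Suc n) = wallis n * (2 * real n + 1)"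
    by (simp add: field_simps)
  have "2 * diffs (one_coeff a) n = (2 * (real n + 1) * wallis (Suc n)) * tsum (Suc n) (replicate a 2)"
    by (simp add: diffs_def one_coeff_def algebra_simps del: wallis.simps)
  also have "\<dots> = (2 * real n + 1) * wallis n * tsum (Suc n) (replicate a 2)"
    unfolding w by simp
  finally have eq: "2 * diffs (one_coeff a) n - (2 * real n + 1) * one_coeff a n =
      (2 * real n + 1) * wallis n * (tsum (Suc n) (replicate a 2) - tsum n (replicate a 2))"
    by (simp add: one_coeff_def algebra_simps)
  show ?thesis
  proof (cases a)
    case 0
    then show ?thesis unfolding eq by simp
  next
    case (Suc b)
    have "tsum (Suc n) (replicate a 2) - tsum n (replicate a 2) = tsum n (replicate b 2) / (2 * real n + 1) ^ 2"
      using tsum_Suc_append_twos[of n "[]" b] Suc by simp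
    moreover have "p * w * (t / p ^ 2) = w * t / p" if "p \<noteq> 0" for p w t :: real
      using that by (simp add: power2_eq_square)
    moreover have "2 * real n + 1 \<noteq> 0" by linarith
    ultimately show ?thesis unfolding eq using Suc by (simp add: one_coeff_def)
  qed
qed

lemma one_series_deriv:
  assumes "norm u < 1"
  obtains D where "(one_series a has_real_derivative D) (at u)"
    "2 * (1 - u) * D - one_series a u = (if a = 0 then 0 else one_series_int (a - 1) u)"
proof
  let ?D = "\<Sum>n. diffs (one_coeff a) n * u ^ n"
  show "(one_series a has_real_derivative ?D) (at u)"
    unfolding one_series_def[abs_def]
    by (rule termdiffs_strong'[OF summable_one_coeff(1) assms])
  have "(\<lambda>n. 2 * (diffs (one_coeff a) n * u ^ n) - 2 * (real n * one_coeff a n * u ^ n) - one_coeff a n * u ^ n)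
      sums (2 * ?D - 2 * (u * ?D) - one_series a u)"
    by (intro sums_diff sums_mult one_series_sums diffs_sums summable_one_coeff(1) assms)
  moreover have "2 * (diffs (one_coeff a) n * u ^ n) - 2 * (real n * one_coeff a n * u ^ n) - one_coeff a n * u ^ n
      = (if a = 0 then 0 else one_coeff (a - 1) n / (2 * real n + 1)) * u ^ n" for n
    unfolding one_coeff_recurrence[symmetric] by (simp only: algebra_simps)
  ultimately have "(\<lambda>n. (if a = 0 then 0 else one_coeff (a - 1) n / (2 * real n + 1)) * u ^ n)
      sums (2 * ?D - 2 * (u * ?D) - one_series a u)"
    by (simp only:)
  moreover have "(\<lambda>n. (if a = 0 then 0 else one_coeff (a - 1) n / (2 * real n + 1)) * u ^ n)
      sums (if a = 0 then 0 else one_series_int (a - 1) u)"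
    using one_series_sums(2)[OF assms, of "a - 1"] by (cases "a = 0") simp_all
  ultimately have "2 * ?D - 2 * (u * ?D) - one_series a u = (if a = 0 then 0 else one_series_int (a - 1) u)"
    by (rule sums_unique2)
  then show "2 * (1 - u) * ?D - one_series a u = (if a = 0 then 0 else one_series_int (a - 1) u)"
    by (simp only: algebra_simps)
qed

lemma sin_power2_less_1:
  fixes x :: real
  assumes "x \<in> {- (pi / 2)<..<pi / 2}"
  shows "norm (sin x ^ 2) < 1"
proof -
  have "0 < cos x" using assms by (intro cos_gt_zero_pi) auto
  then have "0 < cos x ^ 2" by simp
  moreover have "norm (sin x ^ 2) = sin x ^ 2" by simp
  ultimately show ?thesis using sin_cos_squared_add[of x] by linarith
qed

lemma equal_derivs_imp_equal:
  fixes f g :: "real \<Rightarrow> real"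
  assumes "\<And>x. x \<in> {- c<..<c} \<Longrightarrow> (f has_real_derivative h x) (at x)"
    and "\<And>x. x \<in> {- c<..<c} \<Longrightarrow> (g has_real_derivative h x) (at x)"
    and "f 0 = g 0" "x \<in> {- c<..<c}"
  shows "f x = g x"
proof -
  have "f x - g x = f 0 - g 0"
  proof (rule DERIV_isconst3[where f = "\<lambda>x. f x - g x" and a = "- c" and b = c])
    show "((\<lambda>x. f x - g x) has_real_derivative 0) (at y)" if "y \<in> {- c<..<c}" for y
      using DERIV_diff[OF assms(1,2)[OF that]] by simp
  qed (use assms(4) in auto)
  then show ?thesis using assms(3) by simp
qed

text \<open>For a = 0 the derivative is zero. In the induction step two differentiations lead from
  \<open>a + 1\<close> back to \<open>a\<close> on both sides, through sin x times
  \<open>one_series_int a\<close>, and the values at 0 agree.\<close>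

lemma cos_one_series:
  assumes "x \<in> {- (pi / 2)<..<pi / 2}"
  shows "cos x * one_series a (sin x ^ 2) = divpow (2 * a) x"
  using assms
proof (induction a arbitrary: x)
  case 0
  show ?case
  proof (rule equal_derivs_imp_equal[where c = "pi / 2" and h = "\<lambda>_. 0", OF _ _ _ 0])
    fix x :: real assume x: "x \<in> {- (pi / 2)<..<pi / 2}"
    obtain D where D: "(one_series 0 has_real_derivative D) (at (sin x ^ 2))"
      "2 * (1 - sin x ^ 2) * D - one_series 0 (sin x ^ 2) = 0"
      using one_series_deriv[OF sin_power2_less_1[OF x], of 0] by auto
    have "((\<lambda>x. cos x * one_series 0 (sin x ^ 2)) has_real_derivative
        sin x * (2 * cos x ^ 2 * D - one_series 0 (sin x ^ 2))) (at x)"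
      by (rule derivative_eq_intros DERIV_chain2[where g = "\<lambda>x. sin x ^ 2", OF D(1)] refl | simp add: algebra_simps power2_eq_square)+
    then show "((\<lambda>x. cos x * one_series 0 (sin x ^ 2)) has_real_derivative 0) (at x)"
      using D(2) by (simp add: cos_squared_eq)
  next
    show "cos 0 * one_series 0 ((sin 0)\<^sup>2) = divpow (2 * 0) (0 :: real)"
      by (simp add: one_series_def one_coeff_def)
  qed simp_all
next
  case (Suc a)
  have int: "sin x * one_series_int a (sin x ^ 2) = divpow (Suc (2 * a)) x"
    if "x \<in> {- (pi / 2)<..<pi / 2}" for x
  proof (rule equal_derivs_imp_equal[where c = "pi / 2" and h = "divpow (2 * a)", OF _ _ _ that])
    fix x :: real assume x: "x \<in> {- (pi / 2)<..<pi / 2}"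
    obtain D where D: "(one_series_int a has_real_derivative D) (at (sin x ^ 2))"
      "one_series_int a (sin x ^ 2) + 2 * sin x ^ 2 * D = one_series a (sin x ^ 2)"
      using one_series_int_deriv[OF sin_power2_less_1[OF x]] by blast
    have "((\<lambda>x. sin x * one_series_int a (sin x ^ 2)) has_real_derivative
        cos x * (one_series_int a (sin x ^ 2) + 2 * sin x ^ 2 * D)) (at x)"
      by (rule derivative_eq_intros DERIV_chain2[where g = "\<lambda>x. sin x ^ 2", OF D(1)] refl | simp add: algebra_simps power2_eq_square)+
    then show "((\<lambda>x. sin x * one_series_int a (sin x ^ 2)) has_real_derivative divpow (2 * a) x) (at x)"
      unfolding D(2) Suc.IH[OF x] .
    show "(divpow (Suc (2 * a)) has_real_derivative divpow (2 * a) x) (at x)"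
      using has_real_derivative_divpow[OF DERIV_ident, of "2 * a" x UNIV] by simp
  qed simp
  show ?case
  proof (rule equal_derivs_imp_equal[where c = "pi / 2" and h = "divpow (Suc (2 * a))", OF _ _ _ Suc.prems])
    fix x :: real assume x: "x \<in> {- (pi / 2)<..<pi / 2}"
    obtain D where D: "(one_series (Suc a) has_real_derivative D) (at (sin x ^ 2))"
      "2 * (1 - sin x ^ 2) * D - one_series (Suc a) (sin x ^ 2) = one_series_int a (sin x ^ 2)"
      using one_series_deriv[OF sin_power2_less_1[OF x], of "Suc a"] by auto
    have "((\<lambda>x. cos x * one_series (Suc a) (sin x ^ 2)) has_real_derivative
        sin x * (2 * cos x ^ 2 * D - one_series (Suc a) (sin x ^ 2))) (at x)"
      by (rule derivative_eq_intros DERIV_chain2[where g = "\<lambda>x. sin x ^ 2", OF D(1)] refl | simp add: algebra_simps power2_eq_square)+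
    then show "((\<lambda>x. cos x * one_series (Suc a) (sin x ^ 2)) has_real_derivative divpow (Suc (2 * a)) x) (at x)"
      unfolding cos_squared_eq D(2) int[OF x] .
    show "(divpow (2 * Suc a) has_real_derivative divpow (Suc (2 * a)) x) (at x)"
      using has_real_derivative_divpow[OF DERIV_ident, of "Suc (2 * a)" x UNIV] by simp
  next
    show "cos 0 * one_series (Suc a) ((sin 0)\<^sup>2) = divpow (2 * Suc a) (0 :: real)"
      by (simp add: one_series_def one_coeff_def tsum_0)
  qed
qed

lemma sums_one_coeff_cos:
  assumes "x \<in> {0<..<pi / 2}"
  shows "(\<lambda>n. one_coeff a n * cos x ^ (2 * n)) sums (divpow (2 * a) (pi / 2 - x) / sin x)"
proof -
  let ?y = "pi / 2 - x"
  have y: "?y \<in> {- (pi / 2)<..<pi / 2}" using assms by auto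
  have "sin x > 0" using assms by (intro sin_gt_zero) auto
  moreover have "sin ?y = cos x" "cos ?y = sin x"
    by (simp_all add: sin_diff cos_diff)
  ultimately have "one_series a (cos x ^ 2) = divpow (2 * a) ?y / sin x"
    using cos_one_series[OF y, of a] by (simp add: field_simps)
  moreover have "(\<lambda>n. one_coeff a n * (cos x ^ 2) ^ n) sums one_series a (cos x ^ 2)"
    using sin_power2_less_1[OF y] \<open>sin ?y = cos x\<close> by (intro one_series_sums) simp
  ultimately show ?thesis by (simp add: power_mult)
qed

text \<open>Terms of constant sign make the full sum dominate all partial sums; this supplies the
  majorant for dominated convergence.\<close>

lemma abs_sum_le_abs_sums:
  fixes g :: "nat \<Rightarrow> real"
  assumes "g sums s" "(\<forall>n. 0 \<le> g n) \<or> (\<forall>n. g n \<le> 0)"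
  shows "\<bar>\<Sum>n<N. g n\<bar> \<le> \<bar>s\<bar>"
proof -
  have nonneg: "0 \<le> (\<Sum>n<N. h n) \<and> (\<Sum>n<N. h n) \<le> t" if "h sums t" "\<forall>n. 0 \<le> h n" for h :: "nat \<Rightarrow> real" and t
  proof
    show "0 \<le> (\<Sum>n<N. h n)" using that by (intro sum_nonneg) simp
    have "(\<Sum>n<N. h n) \<le> suminf h"
      using that by (intro sum_le_suminf) (auto simp: sums_iff)
    then show "(\<Sum>n<N. h n) \<le> t" using that by (simp add: sums_iff)
  qed
  from assms(2) show ?thesis
  proof
    assume "\<forall>n. 0 \<le> g n"
    then show ?thesis using nonneg[OF assms(1)] by simp
  next
    assume "\<forall>n. g n \<le> 0"
    then show ?thesis using nonneg[OF sums_minus[OF assms(1)]] by (simp add: sum_negf)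
  qed
qed

text \<open>The series for the divided power over sin x is integrated termwise against the cosine
  moments. Subtracting c, the value at 0 of the product of divided powers, removes the pole of the
  cotangent and accounts for the divergent part c \<open>odd_harm N\<close>.\<close>

theorem tsum_two_one_two_tendsto:
  fixes h :: "real \<Rightarrow> real" and a b :: nat
  defines "c \<equiv> divpow (2 * a) (pi / 2) * divpow (2 * b) 0"
  assumes cont: "continuous_on {0..pi / 2} h"
    and h: "\<And>x. x \<in> {0<..<pi / 2} \<Longrightarrow>
      h x = cos x / sin x * (divpow (2 * a) (pi / 2 - x) * divpow (2 * b) x - c)"
  shows "(\<lambda>N. tsum N (replicate a 2 @ [1] @ replicate b 2) - c * odd_harm N)
    \<longlonglongrightarrow> integral {0..pi / 2} h"
proof -
  define w where "w i = replicate a (2 :: nat) @ [1] @ replicate i 2" for i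
  \<comment> \<open>The integral of \<open>g n\<close> is the contribution of middle index n + 1
    minus c / (2n + 1), while the sum over n is the cotangent integrand.\<close>
  define g where "g n x = wallis n * cos x ^ (2 * n + 1) *
    (tsum n (replicate a 2) * divpow (2 * b) x - c)" for n x
  define f where "f N x = (\<Sum>n<N. g n x)" for N x
  have g_sums: "(\<lambda>n. g n x) sums h x" if x: "x \<in> {0<..<pi / 2}" for x
  proof -
    have "(\<lambda>n. cos x * divpow (2 * b) x * (one_coeff a n * cos x ^ (2 * n)) - cos x * c * (one_coeff 0 n * cos x ^ (2 * n)))
      sums (cos x * divpow (2 * b) x * (divpow (2 * a) (pi / 2 - x) / sin x) -
        cos x * c * (divpow (2 * 0) (pi / 2 - x) / sin x))"
      by (intro sums_diff sums_mult sums_one_coeff_cos x)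
    moreover have "cos x * divpow (2 * b) x * (one_coeff a n * cos x ^ (2 * n)) -
        cos x * c * (one_coeff 0 n * cos x ^ (2 * n)) = g n x" for n
      by (simp add: g_def one_coeff_def algebra_simps)
    moreover have "cos x * divpow (2 * b) x * (divpow (2 * a) (pi / 2 - x) / sin x) -
        cos x * c * (divpow (2 * 0) (pi / 2 - x) / sin x) = h x"
      unfolding h[OF x] by (simp add: algebra_simps diff_divide_distrib)
    ultimately show ?thesis by simp
  qed
  \<comment> \<open>For b = 0 the constant c is the limit of the increasing truncated sums, so all
    terms are nonpositive; for b > 0 it is 0 and all terms are nonnegative.\<close>
  have g_sign: "(\<forall>n. 0 \<le> g n x) \<or> (\<forall>n. g n x \<le> 0)" if x: "x \<in> {0<..<pi / 2}" for x
  proof -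
    have "0 < cos x" using x by (intro cos_gt_zero_pi) auto
    then have pos: "0 \<le> wallis n * cos x ^ (2 * n + 1)" for n
      using less_imp_le[OF wallis_pos[of n]] by (intro mult_nonneg_nonneg zero_le_power) auto
    show ?thesis
    proof (cases b)
      case 0
      have "tsum n (replicate a 2) * divpow (2 * b) x - c \<le> 0" for n
        using tsum_twos_le[of n a] 0 by (simp add: c_def)
      then have "\<forall>n. g n x \<le> 0" unfolding g_def by (intro allI mult_nonneg_nonpos pos)
      then show ?thesis ..
    next
      case (Suc b')
      have "0 \<le> tsum n (replicate a 2) * divpow (2 * b) x - c" for n
        using Suc x by (simp add: c_def tsum_nonneg divpow_nonneg)
      then have "\<forall>n. 0 \<le> g n x" unfolding g_def by (intro allI mult_nonneg_nonneg pos)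
      then show ?thesis ..
    qed
  qed
  have int_f: "(f N has_integral (\<Sum>i\<le>b. tsum N (w i) * two_tail N (b - i)) - c * odd_harm N) {0..pi / 2}" for N
  proof -
    have "(g n has_integral (tsum n (replicate a 2) * (wallis n * cos_moment (2 * n + 1) (2 * b))
        - c * (wallis n * cos_moment (2 * n + 1) 0))) {0..pi / 2}" for n
    proof -
      have "((\<lambda>x. tsum n (replicate a 2) * (wallis n * (cos x ^ (2 * n + 1) * divpow (2 * b) x))
          - c * (wallis n * (cos x ^ (2 * n + 1) * divpow 0 x))) has_integral
        (tsum n (replicate a 2) * (wallis n * cos_moment (2 * n + 1) (2 * b))
          - c * (wallis n * cos_moment (2 * n + 1) 0))) {0..pi / 2}"
        by (intro has_integral_diff has_integral_mult_right has_integral_cos_moment)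
      moreover have "(\<lambda>x. tsum n (replicate a 2) * (wallis n * (cos x ^ (2 * n + 1) * divpow (2 * b) x))
          - c * (wallis n * (cos x ^ (2 * n + 1) * divpow 0 x))) = g n"
        by (simp add: g_def fun_eq_iff algebra_simps)
      ultimately show ?thesis by simp
    qed
    moreover have "tsum n (replicate a 2) * (wallis n * cos_moment (2 * n + 1) (2 * b))
        - c * (wallis n * cos_moment (2 * n + 1) 0) =
      tsum n (replicate a 2) / (2 * real n + 1) * two_tail (Suc n) b - c * (1 / (2 * real n + 1))" for n
    proof -
      have p: "2 * real n + 1 \<noteq> 0" by linarith
      have eq: "wallis n * cos_moment (2 * n + 1) (2 * b) = two_tail (Suc n) b / (2 * real n + 1)" for b
        using p by simp
      show ?thesis using eq[of b] eq[of 0] unfolding two_tail_0 by simp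
    qed
    ultimately have "(g n has_integral tsum n (replicate a 2) / (2 * real n + 1) * two_tail (Suc n) b
        - c * (1 / (2 * real n + 1))) {0..pi / 2}" for n
      by simp
    then have "(f N has_integral (\<Sum>n<N. tsum n (replicate a 2) / (2 * real n + 1) * two_tail (Suc n) b
        - c * (1 / (2 * real n + 1)))) {0..pi / 2}"
      unfolding f_def by (intro has_integral_sum) simp_all
    moreover have "(\<Sum>n<N. tsum n (replicate a 2) / (2 * real n + 1) * two_tail (Suc n) b
        - c * (1 / (2 * real n + 1))) = (\<Sum>i\<le>b. tsum N (w i) * two_tail N (b - i)) - c * odd_harm N"
      unfolding sum_subtractf sum_two_one_two_tail w_def odd_harm_def sum_distrib_left ..
    ultimately show ?thesis by simp
  qed
  \<comment> \<open>Pointwise convergence is known on the open interval only; the endpoints do not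
    affect the integrals.\<close>
  have "(\<lambda>N. integral {0<..<pi / 2} (f N)) \<longlonglongrightarrow> integral {0<..<pi / 2} h"
  proof (rule dominated_convergence(2)[where h = "\<lambda>x. \<bar>h x\<bar>"])
    show "f N integrable_on {0<..<pi / 2}" for N
      using int_f[of N] integrable_on_Icc_iff_Ioo by blast
    have "(\<lambda>x. \<bar>h x\<bar>) integrable_on {0..pi / 2}"
      by (intro integrable_continuous_interval continuous_on_rabs cont)
    then show "(\<lambda>x. \<bar>h x\<bar>) integrable_on {0<..<pi / 2}"
      using integrable_on_Icc_iff_Ioo by blast
    show "norm (f N x) \<le> \<bar>h x\<bar>" if "x \<in> {0<..<pi / 2}" for N x
      unfolding f_def real_norm_def by (rule abs_sum_le_abs_sums[OF g_sums[OF that] g_sign[OF that]])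
    show "(\<lambda>N. f N x) \<longlonglongrightarrow> h x" if "x \<in> {0<..<pi / 2}" for x
      using g_sums[OF that] unfolding sums_def f_def .
  qed
  then have lim: "(\<lambda>N. (\<Sum>i\<le>b. tsum N (w i) * two_tail N (b - i)) - c * odd_harm N)
      \<longlonglongrightarrow> integral {0..pi / 2} h"
    unfolding integral_open_interval_real[symmetric] integral_unique[OF int_f] .
  have "(\<lambda>N. (\<Sum>i\<le>b. tsum N (w i) * two_tail N (b - i)) - tsum N (w b)) \<longlonglongrightarrow> 0"
    by (intro tendsto_last_of_convolution) (auto simp: w_def is_index_def)
  from tendsto_diff[OF lim this] show ?thesis by (simp add: w_def)
qed

section \<open>The cotangent integral\<close>

text \<open>A uniform polynomial approximation of \<open>u\<close> can be integrated by parts. The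
  boundary terms vanish because sin (2Nx) is zero at both endpoints, and what remains is of order
  1/N.\<close>

lemma Riemann_Lebesgue_cos:
  fixes u :: "real \<Rightarrow> real"
  assumes cont: "continuous_on {0..pi / 2} u"
  shows "(\<lambda>N. integral {0..pi / 2} (\<lambda>x. u x * cos (2 * real N * x))) \<longlonglongrightarrow> 0"
proof (rule LIMSEQ_I)
  fix e :: real assume e: "0 < e"
  \<comment> \<open>The tolerance e / pi costs e / 2 over an interval of length pi / 2.\<close>
  obtain g where g: "real_polynomial_function g" "\<And>x. x \<in> {0..pi / 2} \<Longrightarrow> \<bar>u x - g x\<bar> < e / pi"
    using Stone_Weierstrass_real_polynomial_function[OF compact_Icc cont, of "e / pi"] e by auto
  obtain g' where g': "real_polynomial_function g'" "\<And>x. (g has_real_derivative g' x) (at x)"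
    using has_real_derivative_polynomial_function[OF g(1)] by blast
  have cont_g: "continuous_on S g" "continuous_on S g'" for S
    using g(1) g'(1) by (auto intro: continuous_on_polymonial_function simp: real_polynomial_function_eq)
  have "bounded (g' ` {0..pi / 2})"
    by (intro compact_imp_bounded compact_continuous_image cont_g(2) compact_Icc)
  then obtain B where B: "\<And>x. x \<in> {0..pi / 2} \<Longrightarrow> \<bar>g' x\<bar> \<le> B"
    unfolding bounded_iff real_norm_def by blast
  have "(\<lambda>N. B * pi / (4 * real N)) \<longlonglongrightarrow> 0" by real_asymp
  then obtain N0 where N0: "\<And>N. N \<ge> N0 \<Longrightarrow> \<bar>B * pi / (4 * real N)\<bar> < e / 2"
    using e LIMSEQ_D[of _ 0 "e / 2"] by force
  show "\<exists>N0. \<forall>N\<ge>N0. norm (integral {0..pi / 2} (\<lambda>x. u x * cos (2 * real N * x)) - 0) < e"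
  proof (intro exI allI impI)
    fix N assume N: "max 1 N0 \<le> N"
    let ?m = "2 * real N"
    have m: "?m > 0" using N by simp
    have g_cos: "((\<lambda>x. g x * cos (?m * x)) has_integral integral {0..pi / 2} (\<lambda>x. g x * cos (?m * x))) {0..pi / 2}"
      by (intro integrable_integral integrable_continuous_interval continuous_intros cont_g)
    have g'_sin: "((\<lambda>x. g' x * sin (?m * x) / ?m) has_integral
        integral {0..pi / 2} (\<lambda>x. g' x * sin (?m * x) / ?m)) {0..pi / 2}"
      using m by (intro integrable_integral integrable_continuous_interval continuous_intros cont_g) auto
    have u_g: "((\<lambda>x. (u x - g x) * cos (?m * x)) has_integral
        integral {0..pi / 2} (\<lambda>x. (u x - g x) * cos (?m * x))) {0..pi / 2}"
      by (intro integrable_integral integrable_continuous_interval continuous_intros cont_g cont)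
    have "((\<lambda>x. g' x * sin (?m * x) / ?m + g x * cos (?m * x)) has_integral
        g (pi / 2) * sin (?m * (pi / 2)) / ?m - g 0 * sin (?m * 0) / ?m) {0..pi / 2}"
    proof (rule has_integral_0_pi_half)
      fix x
      have "((\<lambda>x. sin (?m * x)) has_real_derivative cos (?m * x) * ?m) (at x)"
        by (auto intro!: derivative_eq_intros)
      then have "((\<lambda>x. g x * sin (?m * x) / ?m) has_real_derivative
          (g x * (cos (?m * x) * ?m) + g' x * sin (?m * x)) / ?m) (at x)"
        by (intro DERIV_cdivide DERIV_mult' g'(2))
      also have "(g x * (cos (?m * x) * ?m) + g' x * sin (?m * x)) / ?m = g' x * sin (?m * x) / ?m + g x * cos (?m * x)"
        using m by (simp add: add_divide_distrib)
      finally show "((\<lambda>x. g x * sin (?m * x) / ?m) has_real_derivative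
          g' x * sin (?m * x) / ?m + g x * cos (?m * x)) (at x)" .
    qed
    moreover have "sin (?m * (pi / 2)) = 0"
      using sin_npi[of N] by (simp add: mult.commute)
    ultimately have "integral {0..pi / 2} (\<lambda>x. g' x * sin (?m * x) / ?m) +
        integral {0..pi / 2} (\<lambda>x. g x * cos (?m * x)) = 0"
      using has_integral_unique[OF has_integral_add[OF g'_sin g_cos]] by simp
    moreover have "\<bar>integral {0..pi / 2} (\<lambda>x. g' x * sin (?m * x) / ?m)\<bar> \<le> B / ?m * (pi / 2 - 0)"
    proof -
      have "norm (integral {0..pi / 2} (\<lambda>x. g' x * sin (?m * x) / ?m)) \<le> B / ?m * measure lborel {0..pi / 2}"
      proof (rule has_integral_bound_real[OF _ finite.emptyI g'_sin])
        show "0 \<le> B / ?m" using B[of 0] m by (simp add: order.trans[OF abs_ge_zero])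
        fix x assume x: "x \<in> {0..pi / 2} - {}"
        have "\<bar>g' x\<bar> * \<bar>sin (?m * x)\<bar> \<le> B * 1"
          using B[of x] x by (intro mult_mono) auto
        then show "norm (g' x * sin (?m * x) / ?m) \<le> B / ?m"
          using m by (simp add: abs_mult divide_right_mono)
      qed
      then show ?thesis by simp
    qed
    moreover have "\<bar>integral {0..pi / 2} (\<lambda>x. (u x - g x) * cos (?m * x))\<bar> \<le> e / pi * (pi / 2 - 0)"
    proof -
      have "norm (integral {0..pi / 2} (\<lambda>x. (u x - g x) * cos (?m * x))) \<le> e / pi * measure lborel {0..pi / 2}"
      proof (rule has_integral_bound_real[OF _ finite.emptyI u_g])
        show "0 \<le> e / pi" using e by simp
        fix x assume x: "x \<in> {0..pi / 2} - {}"
        have "\<bar>u x - g x\<bar> * \<bar>cos (?m * x)\<bar> \<le> e / pi * 1"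
          using g(2)[of x] x by (intro mult_mono) auto
        then show "norm ((u x - g x) * cos (?m * x)) \<le> e / pi" by (simp add: abs_mult)
      qed
      then show ?thesis by simp
    qed
    moreover have "integral {0..pi / 2} (\<lambda>x. u x * cos (?m * x)) =
        integral {0..pi / 2} (\<lambda>x. (u x - g x) * cos (?m * x)) + integral {0..pi / 2} (\<lambda>x. g x * cos (?m * x))"
      using integral_unique[OF has_integral_add[OF u_g g_cos]] by (simp add: algebra_simps)
    moreover have "B / ?m * (pi / 2 - 0) < e / 2"
    proof -
      have "B / ?m * (pi / 2 - 0) = B * pi / (4 * real N)" by simp
      also have "\<dots> \<le> \<bar>B * pi / (4 * real N)\<bar>" by (rule abs_ge_self)
      also have "\<dots> < e / 2" using N by (intro N0) simp
      finally show ?thesis .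
    qed
    moreover have "e / pi * (pi / 2 - 0) = e / 2" by simp
    ultimately show "norm (integral {0..pi / 2} (\<lambda>x. u x * cos (?m * x)) - 0) < e"
      unfolding real_norm_def by linarith
  qed
qed

text \<open>The continuous extension of \<open>x * cot x\<close> to \<open>0\<close>, where \<open>cos x / sin x\<close> is the junk value \<open>0\<close>.\<close>

definition x_cot :: "real \<Rightarrow> real" where
  "x_cot x = (if x = 0 then 1 else x * cos x / sin x)"

lemma continuous_on_x_cot: "continuous_on {0..pi / 2} x_cot"
proof -
  have "isCont x_cot x" if x: "x \<in> {0..pi / 2}" for x
  proof (cases "x = 0")
    case True
    have "((\<lambda>x :: real. x * cos x / sin x) \<longlongrightarrow> 1) (at 0)" by real_asymp
    moreover have "\<forall>\<^sub>F x in at 0. x * cos x / sin x = x_cot x"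
      by (auto simp: x_cot_def eventually_at_filter)
    ultimately have "(x_cot \<longlongrightarrow> 1) (at 0)" by (rule Lim_transform_eventually)
    then show ?thesis using True by (simp add: isCont_def x_cot_def)
  next
    case False
    then have "sin x > 0" using x pi_gt_zero by (intro sin_gt_zero) auto
    then have "isCont (\<lambda>x. x * cos x / sin x) x" by (intro continuous_intros) auto
    moreover have "\<forall>\<^sub>F y in nhds x. x_cot y = y * cos y / sin y"
      using t1_space_nhds[OF False] by (rule eventually_mono) (simp add: x_cot_def)
    then have "isCont x_cot x = isCont (\<lambda>x. x * cos x / sin x) x" by (rule isCont_cong)
    ultimately show ?thesis by blast
  qed
  then show ?thesis by (intro continuous_at_imp_continuous_on) blast
qed

text \<open>A finite form of cot x = 2 (sin 2x + sin 4x + ...), obtained by telescoping. Its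
  oscillating term cos (2Nx) is removed in the limit by \<open>Riemann_Lebesgue_cos\<close>.\<close>

lemma cos_mult_one_minus_cos:
  fixes x :: real
  shows "cos x * (1 - cos (2 * real N * x)) =
    sin x * (\<Sum>k<N. sin (2 * real k * x) + sin (2 * real (Suc k) * x))"
proof (induction N)
  case (Suc N)
  let ?y = "(2 * real N + 1) * x"
  have "2 * real N * x = ?y - x" "2 * real (Suc N) * x = ?y + x" by (simp_all add: algebra_simps)
  then have "cos x * (cos (2 * real N * x) - cos (2 * real (Suc N) * x)) =
      sin x * (sin (2 * real N * x) + sin (2 * real (Suc N) * x))"
    by (simp only: cos_diff cos_add sin_diff sin_add) (simp add: algebra_simps)
  then show ?case using Suc by (simp add: algebra_simps)
qed simp

section \<open>Sine moments and the evaluation of the cotangent integral\<close>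

definition sin_moment :: "real poly \<Rightarrow> nat \<Rightarrow> real" where
  "sin_moment r k = integral {0..pi / 2} (\<lambda>x. sin (2 * real k * x) * poly r x)"

lemma has_integral_sin_moment:
  "((\<lambda>x. sin (2 * real k * x) * poly r x) has_integral sin_moment r k) {0..pi / 2}"
  unfolding sin_moment_def
  by (intro integrable_integral integrable_continuous_interval continuous_intros)

lemma sin_moments_tendsto:
  "(\<lambda>N. \<Sum>k<N. sin_moment (pCons 0 q) k + sin_moment (pCons 0 q) (Suc k)) \<longlonglongrightarrow>
    integral {0..pi / 2} (\<lambda>x. x_cot x * poly q x)"
proof -
  let ?u = "\<lambda>x. x_cot x * poly q x"
  let ?r = "pCons 0 q"
  have cont: "continuous_on {0..pi / 2} ?u"
    by (intro continuous_intros continuous_on_x_cot)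
  have "(\<Sum>k<N. sin_moment ?r k + sin_moment ?r (Suc k)) =
      integral {0..pi / 2} ?u - integral {0..pi / 2} (\<lambda>x. ?u x * cos (2 * real N * x))" for N
  proof -
    have "((\<lambda>x. \<Sum>k<N. sin (2 * real k * x) * poly ?r x + sin (2 * real (Suc k) * x) * poly ?r x) has_integral
        (\<Sum>k<N. sin_moment ?r k + sin_moment ?r (Suc k))) {0..pi / 2}"
      by (intro has_integral_sum has_integral_add has_integral_sin_moment) simp
    moreover have "((\<lambda>x. ?u x - ?u x * cos (2 * real N * x)) has_integral
        integral {0..pi / 2} ?u - integral {0..pi / 2} (\<lambda>x. ?u x * cos (2 * real N * x))) {0..pi / 2}"
      by (intro has_integral_diff integrable_integral integrable_continuous_interval continuous_intros
          continuous_on_x_cot)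
    moreover have "(\<Sum>k<N. sin (2 * real k * x) * poly ?r x + sin (2 * real (Suc k) * x) * poly ?r x) =
        ?u x - ?u x * cos (2 * real N * x)" if x: "x \<in> {0..pi / 2}" for x
    proof (cases "x = 0")
      case False
      then have s: "sin x > 0" using x pi_gt_zero by (intro sin_gt_zero) auto
      have "(\<Sum>k<N. sin (2 * real k * x) * poly ?r x + sin (2 * real (Suc k) * x) * poly ?r x) =
          (\<Sum>k<N. sin (2 * real k * x) + sin (2 * real (Suc k) * x)) * poly ?r x"
        unfolding sum_distrib_right by (simp only: distrib_right)
      also have "(\<Sum>k<N. sin (2 * real k * x) + sin (2 * real (Suc k) * x)) =
          cos x * (1 - cos (2 * real N * x)) / sin x"
        unfolding cos_mult_one_minus_cos using s by simp
      also have "\<dots> * poly ?r x = ?u x - ?u x * cos (2 * real N * x)"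
        using False s by (simp add: x_cot_def field_simps)
      finally show ?thesis .
    qed simp
    ultimately show ?thesis
      by (metis (no_types, lifting) has_integral_eq has_integral_unique)
  qed
  moreover have "(\<lambda>N. integral {0..pi / 2} ?u - integral {0..pi / 2} (\<lambda>x. ?u x * cos (2 * real N * x)))
      \<longlonglongrightarrow> integral {0..pi / 2} ?u - 0"
    by (intro tendsto_diff tendsto_const Riemann_Lebesgue_cos cont)
  ultimately show ?thesis by simp
qed

text \<open>Since the moment at k = 0 vanishes, the paired partial sums differ from twice the plain
  ones only by the N-th moment, which summability sends to 0.\<close>

lemma x_cot_integral_sums:
  assumes "summable (\<lambda>n. sin_moment (pCons 0 q) (Suc n))"
  shows "(\<lambda>n. 2 * sin_moment (pCons 0 q) (Suc n)) sums integral {0..pi / 2} (\<lambda>x. x_cot x * poly q x)"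
proof -
  let ?s = "sin_moment (pCons 0 q)"
  have "(\<Sum>k<N. ?s k + ?s (Suc k)) = (\<Sum>k<N. 2 * ?s (Suc k)) - ?s N" for N
  proof (induction N)
    case 0
    show ?case by (simp add: sin_moment_def)
  qed simp
  moreover have "?s \<longlonglongrightarrow> 0"
    using summable_LIMSEQ_zero[OF assms] by (rule LIMSEQ_imp_Suc)
  ultimately show ?thesis
    using tendsto_add[OF sin_moments_tendsto[of q] \<open>?s \<longlonglongrightarrow> 0\<close>] by (simp add: sums_def)
qed

text \<open>Repeated integration by parts, which stops because the derivative of order 2M + 2 is
  zero. \<open>F\<close> is the resulting antiderivative; its sine terms vanish at both endpoints
  and cos (k pi) gives the sign.\<close>

lemma sin_moment_eq:
  assumes deg: "(pderiv ^^ (2 * M + 2)) r = 0" and k: "k > 0"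
  shows "sin_moment r k = (\<Sum>j\<le>M. (-1) ^ j / (2 * real k) ^ (2 * j + 1) *
    (poly ((pderiv ^^ (2 * j)) r) 0 - (-1) ^ k * poly ((pderiv ^^ (2 * j)) r) (pi / 2)))"
proof -
  define m where "m = 2 * real k"
  have m: "m \<noteq> 0" using k by (simp add: m_def)
  define P where "P i x = poly ((pderiv ^^ i) r) x" for i x
  have P_deriv: "(P i has_real_derivative P (Suc i) x) (at x)" for i x
    unfolding P_def[abs_def] by (auto intro!: derivative_eq_intros)
  \<comment> \<open>The derivative of the j-th summand of \<open>F\<close> is sin (mx)
    (\<open>A j x\<close> - \<open>A (Suc j) x\<close>), so the sum telescopes.\<close>
  define A where "A j x = (-1) ^ j * P (2 * j) x / m ^ (2 * j)" for j x
  define F where "F x = (\<Sum>j\<le>M. (-1) ^ j *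
    (sin (m * x) / m ^ (2 * j + 2) * P (2 * j + 1) x - cos (m * x) / m ^ (2 * j + 1) * P (2 * j) x))" for x
  have "(F has_real_derivative sin (m * x) * poly r x) (at x)" for x
  proof -
    have "(F has_real_derivative (\<Sum>j\<le>M. sin (m * x) * (A j x - A (Suc j) x))) (at x)"
      unfolding F_def
    proof (rule DERIV_sum)
      fix j
      have "((\<lambda>x. (-1) ^ j * (sin (m * x) / m ^ (2 * j + 2) * P (2 * j + 1) x -
          cos (m * x) / m ^ (2 * j + 1) * P (2 * j) x)) has_real_derivative
        (-1) ^ j * ((sin (m * x) / m ^ (2 * j + 2) * P (Suc (2 * j + 1)) x + cos (m * x) * m / m ^ (2 * j + 2) * P (2 * j + 1) x) -
          (cos (m * x) / m ^ (2 * j + 1) * P (Suc (2 * j)) x + - sin (m * x) * m / m ^ (2 * j + 1) * P (2 * j) x))) (at x)"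
        by (intro DERIV_cmult DERIV_diff DERIV_mult' DERIV_cdivide P_deriv)
          (auto intro!: derivative_eq_intros)
      also have "(-1) ^ j * ((sin (m * x) / m ^ (2 * j + 2) * P (Suc (2 * j + 1)) x + cos (m * x) * m / m ^ (2 * j + 2) * P (2 * j + 1) x) -
          (cos (m * x) / m ^ (2 * j + 1) * P (Suc (2 * j)) x + - sin (m * x) * m / m ^ (2 * j + 1) * P (2 * j) x)) =
        sin (m * x) * (A j x - A (Suc j) x)"
      proof -
        have eq: "e * ((s / (m * m * u) * p2 + c * m / (m * m * u) * p1) - (c / (m * u) * p1 + - s * m / (m * u) * p0)) =
            s * (e * p0 / u - (- e) * p2 / (m * m * u))" if "u \<noteq> 0" for e c s u p0 p1 p2
          using that m by (simp add: field_simps)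
        have "m ^ (2 * j + 2) = m * m * m ^ (2 * j)" "m ^ (2 * j + 1) = m * m ^ (2 * j)"
          by simp_all
        moreover have "A (Suc j) x = (- ((-1) ^ j)) * P (Suc (2 * j + 1)) x / (m * m * m ^ (2 * j))"
          by (simp add: A_def)
        moreover have u: "m ^ (2 * j) \<noteq> 0" using m by simp
        ultimately show ?thesis
          unfolding A_def[of j] Suc_eq_plus1[symmetric] by (simp only: eq[OF u])
      qed
      finally show "((\<lambda>x. (-1) ^ j * (sin (m * x) / m ^ (2 * j + 2) * P (2 * j + 1) x -
          cos (m * x) / m ^ (2 * j + 1) * P (2 * j) x)) has_real_derivative
        sin (m * x) * (A j x - A (Suc j) x)) (at x)" .
    qed
    also have "(\<Sum>j\<le>M. sin (m * x) * (A j x - A (Suc j) x)) = sin (m * x) * (A 0 x - A (Suc M) x)"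
      unfolding sum_distrib_left[symmetric] sum_telescope[of "\<lambda>j. A j x"] ..
    also have "A (Suc M) x = 0" using deg by (simp add: A_def P_def)
    finally show ?thesis by (simp add: A_def P_def)
  qed
  then have "((\<lambda>x. sin (m * x) * poly r x) has_integral F (pi / 2) - F 0) {0..pi / 2}"
    by (rule has_integral_0_pi_half)
  then have "sin_moment r k = F (pi / 2) - F 0"
    using has_integral_sin_moment[of k r] has_integral_unique unfolding m_def by blast
  also have "\<dots> = (\<Sum>j\<le>M. (-1) ^ j / m ^ (2 * j + 1) * (P (2 * j) 0 - (-1) ^ k * P (2 * j) (pi / 2)))"
  proof -
    have "sin (m * (pi / 2)) = 0" "cos (m * (pi / 2)) = (-1) ^ k"
      using sin_npi[of k] cos_npi[of k] by (simp_all add: m_def mult.commute)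
    then show ?thesis
      unfolding F_def sum_subtractf[symmetric] using m
      by (intro sum.cong refl) (simp add: field_simps)
  qed
  finally show ?thesis unfolding m_def P_def .
qed

lemma zeta_bar_sums:
  assumes "2 \<le> m"
  shows "(\<lambda>n. (-1) ^ Suc n / real (Suc n) ^ m) sums zeta_bar m"
    and "(\<lambda>n. 1 / real (Suc n) ^ m) sums (- zeta_bar m / (1 - 2 / 2 ^ m))"
proof -
  let ?f = "\<lambda>n. 1 / real (Suc n) ^ m"
  let ?g = "\<lambda>n. (-1) ^ Suc n / real (Suc n) ^ m"
  have "summable (\<lambda>n. inverse (real n ^ m))"
    using inverse_power_summable[OF assms, where 'a = real] by simp
  then have f: "summable ?f"
    by (subst (asm) summable_Suc_iff[symmetric]) (simp add: inverse_eq_divide)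
  have g: "summable ?g"
  proof (rule summable_comparison_test'[OF f])
    show "norm (?g n) \<le> ?f n" for n by (simp add: power_abs abs_mult)
  qed
  then show g_sums: "?g sums zeta_bar m"
    unfolding zeta_bar_def by (rule summable_sums)
  \<comment> \<open>Terms with odd \<open>Suc n\<close> cancel and those with even
    \<open>Suc n\<close> double, leaving a scaled copy of the first N terms of \<open>?f\<close>.
    This relates the two zeta series.\<close>
  have "(\<Sum>n<2 * N. ?f n + ?g n) = 2 / 2 ^ m * (\<Sum>n<N. ?f n)" for N
  proof (induction N)
    case (Suc N)
    have "real (Suc (Suc (2 * N))) = 2 * real (Suc N)" by simp
    then have "?f (Suc (2 * N)) = 1 / (2 ^ m * real (Suc N) ^ m)"
      by (simp only: power_mult_distrib)
    then show ?case using Suc by (simp add: algebra_simps)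
  qed simp
  moreover have "(\<lambda>N. \<Sum>n<2 * N. ?f n + ?g n) \<longlonglongrightarrow> suminf ?f + zeta_bar m"
    using LIMSEQ_subseq_LIMSEQ[OF sums_add[OF summable_sums[OF f] g_sums, unfolded sums_def], of "\<lambda>N. 2 * N"]
    by (simp add: strict_mono_def comp_def)
  moreover have "(\<lambda>N. 2 / 2 ^ m * (\<Sum>n<N. ?f n)) \<longlonglongrightarrow> 2 / 2 ^ m * suminf ?f"
    by (intro tendsto_mult tendsto_const summable_LIMSEQ f)
  ultimately have "suminf ?f + zeta_bar m = 2 / 2 ^ m * suminf ?f"
    using LIMSEQ_unique by simp
  then have "(1 - 2 / 2 ^ m) * suminf ?f = - zeta_bar m" by (simp add: algebra_simps)
  moreover have "1 - 2 / 2 ^ m > (0 :: real)"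
  proof -
    have "(2 :: real) ^ 1 < 2 ^ m" using assms by (intro power_strict_increasing) auto
    then show ?thesis by simp
  qed
  ultimately have "suminf ?f = - zeta_bar m / (1 - 2 / 2 ^ m)"
    by (simp add: field_simps)
  then show "?f sums (- zeta_bar m / (1 - 2 / 2 ^ m))"
    using summable_sums[OF f] by simp
qed

lemma x_cot_integral:
  fixes q :: "real poly"
  defines "r \<equiv> pCons 0 q"
  assumes deg: "(pderiv ^^ (2 * M + 2)) r = 0"
  shows "integral {0..pi / 2} (\<lambda>x. x_cot x * poly q x) = poly r (pi / 2) * ln 2 -
    (\<Sum>j = 1..M. (-1) ^ j / 2 ^ (2 * j) * (poly ((pderiv ^^ (2 * j)) r) (pi / 2) +
      2 ^ (2 * j) / (2 ^ (2 * j) - 1) * poly ((pderiv ^^ (2 * j)) r) 0) * zeta_bar (2 * j + 1))"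
proof -
  define P where "P j x = poly ((pderiv ^^ (2 * j)) r) x" for j x
  define t where "t j n = (-1) ^ j / 2 ^ (2 * j) *
    (P j 0 * (1 / real (Suc n) ^ (2 * j + 1)) - P j (pi / 2) * ((-1) ^ Suc n / real (Suc n) ^ (2 * j + 1)))" for j n
  have "2 * sin_moment r (Suc n) = (\<Sum>j\<le>M. t j n)" for n
  proof -
    have eq: "2 * ((-1) ^ j / (2 * x) ^ (2 * j + 1) * (y - s * z)) =
        (-1) ^ j / 2 ^ (2 * j) * (y * (1 / x ^ (2 * j + 1)) - z * (s / x ^ (2 * j + 1)))"
      if "x > 0" for x y z s :: real and j
      using that by (simp add: power_mult_distrib field_simps)
    show ?thesis
      unfolding sin_moment_eq[OF deg zero_less_Suc] sum_distrib_left t_def P_def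
      by (intro sum.cong refl eq) simp
  qed
  moreover have "(\<lambda>n. \<Sum>j\<le>M. t j n) sums (P 0 (pi / 2) * ln 2 + (\<Sum>j = 1..M. - ((-1) ^ j / 2 ^ (2 * j) * (P j (pi / 2) +
      2 ^ (2 * j) / (2 ^ (2 * j) - 1) * P j 0) * zeta_bar (2 * j + 1))))"
  proof -
    have t_sums: "t j sums (- ((-1) ^ j / 2 ^ (2 * j) * (P j (pi / 2) +
      2 ^ (2 * j) / (2 ^ (2 * j) - 1) * P j 0) * zeta_bar (2 * j + 1)))" if "j \<ge> 1" for j
    proof -
      have "t j sums ((-1) ^ j / 2 ^ (2 * j) * (P j 0 * (- zeta_bar (2 * j + 1) / (1 - 2 / 2 ^ (2 * j + 1))) -
          P j (pi / 2) * zeta_bar (2 * j + 1)))"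
        unfolding t_def[abs_def] using that by (intro sums_mult sums_diff zeta_bar_sums) simp_all
      also have "- zeta_bar (2 * j + 1) / (1 - 2 / 2 ^ (2 * j + 1)) =
          - (2 ^ (2 * j) / (2 ^ (2 * j) - 1) * zeta_bar (2 * j + 1))"
      proof -
        have "(2 :: real) ^ 0 < 2 ^ (2 * j)" using that by (intro power_strict_increasing) auto
        then show ?thesis by (simp add: field_simps)
      qed
      also have "s * (y * - (e * z) - x * z) = - (s * (x + e * y) * z)" for s x y e z :: real
        by (simp add: algebra_simps)
      finally show ?thesis .
    qed
    \<comment> \<open>The zero constant coefficient of \<open>r\<close> removes what would be a
      divergent harmonic series; the endpoint pi/2 leaves the alternating one, with sum log
      2.\<close>
    have "t 0 = (\<lambda>n. P 0 (pi / 2) * ((-1) ^ n / real (Suc n)))"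
      by (simp add: t_def P_def r_def fun_eq_iff)
    then have "t 0 sums (P 0 (pi / 2) * ln 2)"
      by (simp only:) (intro sums_mult alternating_harmonic_series_sums)
    moreover have "(\<lambda>n. \<Sum>j = 1..M. t j n) sums (\<Sum>j = 1..M. - ((-1) ^ j / 2 ^ (2 * j) * (P j (pi / 2) +
      2 ^ (2 * j) / (2 ^ (2 * j) - 1) * P j 0) * zeta_bar (2 * j + 1)))"
      by (intro sums_sum t_sums) simp
    moreover have "(\<Sum>j\<le>M. t j n) = t 0 n + (\<Sum>j = 1..M. t j n)" for n
      by (simp add: atMost_atLeast0 sum.atLeast_Suc_atMost)
    ultimately show ?thesis using sums_add by simp
  qed
  ultimately have sums: "(\<lambda>n. 2 * sin_moment r (Suc n)) sums (P 0 (pi / 2) * ln 2 + (\<Sum>j = 1..M. - ((-1) ^ j / 2 ^ (2 * j) * (P j (pi / 2) +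
      2 ^ (2 * j) / (2 ^ (2 * j) - 1) * P j 0) * zeta_bar (2 * j + 1))))"
    by simp
  then have "summable (\<lambda>n. sin_moment r (Suc n))"
    using sums_summable summable_mult_D by fastforce
  from sums_unique2[OF x_cot_integral_sums[OF this[unfolded r_def], folded r_def] sums] show ?thesis
    by (simp add: P_def sum_negf)
qed

section \<open>Even derivatives at the two endpoints and the final formula\<close>

definition two_poly :: "nat \<Rightarrow> nat \<Rightarrow> real poly" where
  "two_poly a b = smult (1 / (fact (2 * a) * fact (2 * b))) (monom 1 (2 * b) * [:pi / 2, -1:] ^ (2 * a))"

lemma poly_two_poly: "poly (two_poly a b) x = divpow (2 * a) (pi / 2 - x) * divpow (2 * b) x"
  by (simp add: two_poly_def divpow_def poly_monom)

lemma degree_two_poly: "degree (two_poly a b) \<le> 2 * (a + b)"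
proof -
  have "degree (monom 1 (2 * b) * [:pi / 2, -1:] ^ (2 * a)) \<le> 2 * b + 1 * (2 * a)"
    by (intro order.trans[OF degree_mult_le] add_mono degree_monom_le order.trans[OF degree_power_le]) simp
  then show ?thesis unfolding two_poly_def by (intro order.trans[OF degree_smult_le]) simp
qed

text \<open>The derivative is a factorial times a coefficient, read off from the binomial theorem.
  Only even powers of -1 occur, and for j < b both sides vanish.\<close>

lemma higher_pderiv_two_poly_0:
  assumes "j \<le> a + b"
  shows "poly ((pderiv ^^ (2 * j)) (two_poly a b)) 0 =
    real ((2 * j) choose (2 * b)) * divpow (2 * (a + b - j)) (pi / 2)"
proof -
  have "poly ((pderiv ^^ (2 * j)) (two_poly a b)) 0 = fact (2 * j) * coeff (two_poly a b) (2 * j)"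
    by (simp add: poly_0_coeff_0 coeff_higher_pderiv pochhammer_fact)
  also have "\<dots> = real ((2 * j) choose (2 * b)) * divpow (2 * (a + b - j)) (pi / 2)"
  proof (cases "j < b")
    case True
    then show ?thesis by (simp add: two_poly_def coeff_monom_mult)
  next
    case False
    define i where "i = j - b"
    have j: "j = i + b" "i \<le> a" using False assms by (auto simp: i_def)
    have "coeff ([:pi / 2, -1:] ^ (2 * a)) (2 * i) = real ((2 * a) choose (2 * i)) * (pi / 2) ^ (2 * (a - i))"
      using j coeff_linear_poly_power[of "2 * i" "2 * a" "pi / 2" "-1"] by (simp add: right_diff_distrib')
    then have "coeff (two_poly a b) (2 * j) = real ((2 * a) choose (2 * i)) * (pi / 2) ^ (2 * (a - i)) / (fact (2 * a) * fact (2 * b))"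
      by (simp add: two_poly_def coeff_monom_mult j(1))
    moreover have "real ((2 * a) choose (2 * i)) = fact (2 * a) / (fact (2 * i) * fact (2 * (a - i)))"
      using j binomial_fact[of "2 * i" "2 * a", where 'a = real] by (simp add: right_diff_distrib')
    moreover have "real ((2 * j) choose (2 * b)) = fact (2 * j) / (fact (2 * b) * fact (2 * i))"
      using j binomial_fact[of "2 * b" "2 * j", where 'a = real] by (simp add: right_diff_distrib')
    moreover have "a + b - j = a - i" using j by simp
    ultimately show ?thesis by (simp add: divpow_def)
  qed
  finally show ?thesis .
qed

lemma higher_pderiv_pcompose_reflect:
  fixes p :: "real poly"
  shows "(pderiv ^^ i) (pcompose p [:c, -1:]) = smult ((-1) ^ i) (pcompose ((pderiv ^^ i) p) [:c, -1:])"
  by (induction i) (simp_all add: pderiv_smult pderiv_pcompose pderiv_pCons)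

text \<open>The reflection of x to pi/2 - x interchanges a and b and leaves derivatives of even
  order without a sign, which reduces the claim to the endpoint 0.\<close>

lemma higher_pderiv_two_poly_pi_half:
  assumes "j \<le> a + b"
  shows "poly ((pderiv ^^ (2 * j)) (two_poly a b)) (pi / 2) =
    real ((2 * j) choose (2 * a)) * divpow (2 * (a + b - j)) (pi / 2)"
proof -
  have "two_poly b a = pcompose (two_poly a b) [:pi / 2, -1:]"
    by (simp add: poly_eq_poly_eq_iff[symmetric] fun_eq_iff poly_pcompose poly_two_poly)
  then have "poly ((pderiv ^^ (2 * j)) (two_poly a b)) (pi / 2) = poly ((pderiv ^^ (2 * j)) (two_poly b a)) 0"
    by (simp add: higher_pderiv_pcompose_reflect poly_pcompose)
  then show ?thesis
    using higher_pderiv_two_poly_0[of j b a] assms by (simp add: add.commute)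
qed

theorem theorem1p1:
  fixes V :: real and a b :: nat
  shows "mtv_stuffle V (replicate a 2 @ [1] @ replicate b 2) =
    - (\<Sum>r=1..a+b. (-1) ^ r * (1 / 2 ^ (2 * r)) *
         (real ((2 * r) choose (2 * a)) +
          2 ^ (2 * r) / (2 ^ (2 * r) - 1) * real ((2 * r) choose (2 * b))) *
         zeta_bar (2 * r + 1) * mtv (replicate (a + b - r) 2))
    + (if a = 0 then 1 else 0) * ln 2 * mtv (replicate b 2)
    + (if b = 0 then 1 else 0) * (V - ln 2) * mtv (replicate a 2)"
proof -
  define c where "c = divpow (2 * a) (pi / 2) * divpow (2 * b) 0"
  \<comment> \<open>The head coefficient is the value at 0, so \<open>q\<close> is the difference
    quotient of \<open>two_poly a b\<close> at 0, and \<open>x_cot x * poly q x\<close> extends the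
    cotangent integrand continuously.\<close>
  obtain c' q where p: "two_poly a b = pCons c' q" by (rule pCons_cases)
  have "poly (two_poly a b) 0 = c" by (simp add: poly_two_poly c_def)
  then have p: "two_poly a b = pCons c q" using p by simp
  define r where "r = pCons 0 q"
  define I where "I = integral {0..pi / 2} (\<lambda>x. x_cot x * poly q x)"
  \<comment> \<open>\<open>r\<close> is \<open>two_poly a b\<close> minus its constant term, so all
    derivatives of positive order agree.\<close>
  have pderiv_r: "(pderiv ^^ i) r = (pderiv ^^ i) (two_poly a b)" if "i > 0" for i
  proof -
    from that obtain k where "i = Suc k" by (cases i) simp_all
    then show ?thesis by (simp add: r_def p pderiv_pCons funpow_Suc_right del: funpow.simps)
  qed
  have "(\<lambda>N. tsum N (replicate a 2 @ [1] @ replicate b 2) - c * odd_harm N) \<longlonglongrightarrow> I"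
    unfolding I_def c_def
  proof (rule tsum_two_one_two_tendsto)
    show "continuous_on {0..pi / 2} (\<lambda>x. x_cot x * poly q x)"
      by (intro continuous_intros continuous_on_x_cot)
    fix x :: real assume x: "x \<in> {0<..<pi / 2}"
    have "divpow (2 * a) (pi / 2 - x) * divpow (2 * b) x - c = x * poly q x"
      using poly_two_poly[of a b x] by (simp add: p)
    then show "x_cot x * poly q x = cos x / sin x * (divpow (2 * a) (pi / 2 - x) * divpow (2 * b) x -
        divpow (2 * a) (pi / 2) * divpow (2 * b) 0)"
      using x by (simp add: x_cot_def c_def)
  qed
  then have "(\<lambda>N. tsum N (replicate a 2 @ [1] @ replicate b 2) - c * odd_harm N - I) \<longlonglongrightarrow> 0"
    by (simp add: LIM_zero_iff)
  then have "(\<lambda>N. tsum N (replicate a 2 @ [1] @ replicate b 2) - poly [:I, c:] (odd_harm N)) \<longlonglongrightarrow> 0"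
    by (simp add: algebra_simps)
  moreover have "is_index (replicate a 2 @ [1] @ replicate b 2)"
    by (auto simp: is_index_def)
  ultimately have "mtv_stuffle V (replicate a 2 @ [1] @ replicate b 2) = poly [:I, c:] V"
    by (intro mtv_stuffle_eqI)
  also have "\<dots> = I + V * c" by simp
  also have "I = poly r (pi / 2) * ln 2 -
    (\<Sum>j = 1..a + b. (-1) ^ j / 2 ^ (2 * j) * (poly ((pderiv ^^ (2 * j)) r) (pi / 2) +
      2 ^ (2 * j) / (2 ^ (2 * j) - 1) * poly ((pderiv ^^ (2 * j)) r) 0) * zeta_bar (2 * j + 1))"
    unfolding I_def r_def
  proof (rule x_cot_integral)
    have "(pderiv ^^ (2 * (a + b) + 2)) (two_poly a b) = 0"
      using degree_two_poly[of a b] by (intro poly_eqI) (simp add: coeff_higher_pderiv coeff_eq_0 del: funpow.simps)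
    then show "(pderiv ^^ (2 * (a + b) + 2)) (pCons 0 q) = 0"
      using pderiv_r[of "2 * (a + b) + 2"] by (simp add: r_def del: funpow.simps)
  qed
  also have "(\<Sum>j = 1..a + b. (-1) ^ j / 2 ^ (2 * j) * (poly ((pderiv ^^ (2 * j)) r) (pi / 2) +
      2 ^ (2 * j) / (2 ^ (2 * j) - 1) * poly ((pderiv ^^ (2 * j)) r) 0) * zeta_bar (2 * j + 1)) =
    (\<Sum>r=1..a+b. (-1) ^ r * (1 / 2 ^ (2 * r)) *
         (real ((2 * r) choose (2 * a)) +
          2 ^ (2 * r) / (2 ^ (2 * r) - 1) * real ((2 * r) choose (2 * b))) *
         zeta_bar (2 * r + 1) * mtv (replicate (a + b - r) 2))"
  proof (rule sum.cong[OF refl])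
    fix j assume "j \<in> {1..a + b}"
    then have j: "j \<le> a + b" "2 * j > 0" by auto
    have alg: "s / d * (x * t + e * (y * t)) * z = s * (1 / d) * (x + e * y) * z * t" for s d x t e y z :: real
      by (simp add: field_simps)
    show "(-1) ^ j / 2 ^ (2 * j) * (poly ((pderiv ^^ (2 * j)) r) (pi / 2) +
        2 ^ (2 * j) / (2 ^ (2 * j) - 1) * poly ((pderiv ^^ (2 * j)) r) 0) * zeta_bar (2 * j + 1) =
      (-1) ^ j * (1 / 2 ^ (2 * j)) * (real ((2 * j) choose (2 * a)) +
        2 ^ (2 * j) / (2 ^ (2 * j) - 1) * real ((2 * j) choose (2 * b))) *
        zeta_bar (2 * j + 1) * mtv (replicate (a + b - j) 2)"
      unfolding pderiv_r[OF j(2)] higher_pderiv_two_poly_0[OF j(1)] higher_pderiv_two_poly_pi_half[OF j(1)]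
        mtv_twos by (rule alg)
  qed
  \<comment> \<open>At pi/2 the polynomial \<open>two_poly a b\<close> vanishes unless a = 0, which
    gives the first logarithm; subtracting c gives the logarithm paired with
    \<open>V\<close>.\<close>
  also have "poly r (pi / 2) = (if a = 0 then 1 else 0) * mtv (replicate b 2) - c"
  proof -
    have "poly r (pi / 2) = poly (two_poly a b) (pi / 2) - c" by (simp add: r_def p)
    also have "poly (two_poly a b) (pi / 2) = (if a = 0 then 1 else 0) * mtv (replicate b 2)"
      by (cases a) (simp_all add: poly_two_poly mtv_twos)
    finally show ?thesis .
  qed
  also have "c = (if b = 0 then 1 else 0) * mtv (replicate a 2)"
    by (cases b) (simp_all add: c_def mtv_twos)
  finally show ?thesis by (simp only: algebra_simps)
qed

end
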